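(* Let $H=(u(x,y,z),v(x,y,z),h(x,y))$ be a polynomial map with $u,v\in\mathbf{K}[x,y,z]$, $h\in\mathbf{K}[x,y]$ and $\deg_z v(x,y,z)\leq 1$. Assume that $H(0)=0$ and that the components of $H$ are linearly independent over $\mathbf{K}$. If $JH$ is nilpotent, then: (1) if $\deg_z u=0$ and $\gcd(\deg_y u,\deg_y h)\leq 3$, then $H$ has form (A); (2) if $\deg_z v=0$ and $\gcd(\deg_x v,\deg_x h)\leq 3$, then $H$ has form (B); (3) if $\deg_z u\cdot\deg_z v\geq 1$ and $\gcd(\deg(u(x,y,0)-\lambda v(x,y,0)),\deg h(x,y))\leq 3$ for some $\lambda\in\mathbf{K}$, then there exists $T\in\operatorname{GL}_3(\mathbf{K})$ such that $T^{-1}HT$ has form (A). Here a polynomial map $(U,V,W)$ is said to have form (A) if $$U=g(ay+b(x)),\quad V=v_1z-a^{-1}b'(x)\,g(ay+b(x))-v_1l_2x,\quad W=c_0U^2+l_2U,$$ with $b(x)=v_1c_0ax^2+l_1x+\tilde{l}_2$, for some $v_1,c_0,a\in\mathbf{K}^*$, $l_1,l_2,\tilde{l}_2\in\mathbf{K}$ and $g(t)\in\mathbf{K}[t]$ with $g(0)=0$ and $\deg_t g(t)\geq 1$; and it is said to have form (B) if $$U=u_1z-a^{-1}b'(y)\,g(ax+b(y))-u_1l_2y,\quad V=g(ax+b(y)),\quad W=c_0V^2+l_2V,$$ with $b(y)=u_1c_0ay^2+l_1y+\tilde{l}_2$, for some $u_1,c_0,a\in\mathbf{K}^*$, $l_1,l_2,\tilde{l}_2\in\mathbf{K}$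 and $g(t)\in\mathbf{K}[t]$ with $g(0)=0$ and $\deg_t g(t)\geq 1$.
   Context: $\mathbf{K}$ is an algebraically closed field and $\mathbf{K}^*=\mathbf{K}\setminus\{0\}$. $JH$ denotes the $3\times 3$ Jacobian matrix of $H$ with respect to $(x,y,z)$. $\deg$ is the total degree and $\deg_y f$ (resp. $\deg_x f$, $\deg_z f$) is the highest degree of $y$ (resp. $x$, $z$) in $f$. $T$ is identified with the linear map it defines on $\mathbf{K}^3$, and $T^{-1}HT$ is the composition $T^{-1}\circ H\circ T$.
   Formalization: K is additionally assumed to have characteristic zero; in characteristic p the statement fails, e.g. H=(x^p, y^p, xy) satisfies all hypotheses of (1) and (2) but has neither form (A) nor form (B). *)

theory Defs
  imports "HOL-Analysis.Analysis" "HOL-Computational_Algebra.Computational_Algebra"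
begin

text \<open>
  The ring \<open>K[x,y,z]\<close> is represented as \<open>K[x][y][z]\<close>: the outermost polynomial variable is
  \<open>z\<close>, the middle one is \<open>y\<close> and the innermost one is \<open>x\<close>.
\<close>

type_synonym 'a poly3 = "'a poly poly poly"

definition Const3 :: "'a::comm_ring_1 \<Rightarrow> 'a poly3" where
  "Const3 c = [:[:[:c:]:]:]"

definition varX :: "'a::comm_ring_1 poly3" where "varX = [:[:[:0, 1:]:]:]"
definition varY :: "'a::comm_ring_1 poly3" where "varY = [:[:0, 1:]:]"
definition varZ :: "'a::comm_ring_1 poly3" where "varZ = [:0, 1:]"

text \<open>The coefficient of \<open>x^i * y^j * z^k\<close>.\<close>

definition coeff3 :: "'a::zero poly3 \<Rightarrow> nat \<Rightarrow> nat \<Rightarrow> nat \<Rightarrow> 'a" where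
  "coeff3 p i j k = coeff (coeff (coeff p k) j) i"

text \<open>All degrees are natural numbers; the zero polynomial gets degree 0.\<close>

definition deg_x :: "'a::zero poly3 \<Rightarrow> nat" where
  "deg_x p = Max (insert 0 {i. \<exists>j k. coeff3 p i j k \<noteq> 0})"

definition deg_y :: "'a::zero poly3 \<Rightarrow> nat" where
  "deg_y p = Max (insert 0 {j. \<exists>i k. coeff3 p i j k \<noteq> 0})"

definition deg_z :: "'a::zero poly3 \<Rightarrow> nat" where
  "deg_z p = Max (insert 0 {k. \<exists>i j. coeff3 p i j k \<noteq> 0})"

definition total_deg :: "'a::zero poly3 \<Rightarrow> nat" where
  "total_deg p = Max (insert 0 {i + j + k |i j k. coeff3 p i j k \<noteq> 0})"

definition subst1 :: "'a::comm_ring_1 poly \<Rightarrow> 'a poly3 \<Rightarrow> 'a poly3" where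
  "subst1 p t = poly (map_poly Const3 p) t"

text \<open>\<open>subst3 p a b c\<close> is \<open>p(a,b,c)\<close> with \<open>a, b, c\<close> in \<open>K[x,y,z]\<close>.\<close>

definition subst3 :: "'a::comm_ring_1 poly3 \<Rightarrow> 'a poly3 \<Rightarrow> 'a poly3 \<Rightarrow> 'a poly3 \<Rightarrow> 'a poly3" where
  "subst3 p a b c =
     poly (map_poly (\<lambda>q. poly (map_poly (\<lambda>r. subst1 r a) q) b) p) c"

definition eval3 :: "'a::comm_ring_1 poly3 \<Rightarrow> 'a \<Rightarrow> 'a \<Rightarrow> 'a \<Rightarrow> 'a" where
  "eval3 p a b c = poly (poly (poly p [:[:c:]:]) [:b:]) a"

definition diff_x :: "'a::idom poly3 \<Rightarrow> 'a poly3" where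
  "diff_x p = map_poly (map_poly pderiv) p"

definition diff_y :: "'a::idom poly3 \<Rightarrow> 'a poly3" where
  "diff_y p = map_poly pderiv p"

definition diff_z :: "'a::idom poly3 \<Rightarrow> 'a poly3" where
  "diff_z p = pderiv p"

definition poly_jacobian :: "('a::idom poly3)^3 \<Rightarrow> ('a poly3)^3^3" where
  "poly_jacobian H = (\<chi> i. vector [diff_x (H $ i), diff_y (H $ i), diff_z (H $ i)])"

definition nilpotent_matrix :: "'a::semiring_1^'n^'n \<Rightarrow> bool" where
  "nilpotent_matrix A \<longleftrightarrow> (\<exists>m. (((**) A) ^^ m) (mat 1) = 0)"

definition lin_indep3 :: "('a::comm_ring_1 poly3)^3 \<Rightarrow> bool" where
  "lin_indep3 H \<longleftrightarrow>
     (\<forall>c :: 'a^3. (\<Sum>i\<in>UNIV. Const3 (c $ i) * H $ i) = 0 \<longrightarrow> c = 0)"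

text \<open>The polynomial map given by a matrix, and composition \<open>F \<circ> G\<close> of polynomial maps.\<close>

definition linear_map3 :: "'a::comm_ring_1^3^3 \<Rightarrow> ('a poly3)^3" where
  "linear_map3 T = (\<chi> i. Const3 (T $ i $ 1) * varX + Const3 (T $ i $ 2) * varY
                        + Const3 (T $ i $ 3) * varZ)"

definition comp3 :: "('a::comm_ring_1 poly3)^3 \<Rightarrow> ('a poly3)^3 \<Rightarrow> ('a poly3)^3" where
  "comp3 F G = (\<chi> i. subst3 (F $ i) (G $ 1) (G $ 2) (G $ 3))"

definition conj3 :: "'a::field^3^3 \<Rightarrow> ('a poly3)^3 \<Rightarrow> ('a poly3)^3" where
  "conj3 T H = comp3 (linear_map3 (matrix_inv T)) (comp3 H (linear_map3 T))"

definition form_A :: "('a::field poly3)^3 \<Rightarrow> bool" where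
  "form_A H \<longleftrightarrow>
     (\<exists>v1 c0 a l1 l2 l2' :: 'a. \<exists>g b :: 'a poly.
        v1 \<noteq> 0 \<and> c0 \<noteq> 0 \<and> a \<noteq> 0 \<and> poly g 0 = 0 \<and> degree g \<ge> 1 \<and>
        b = [:l2', l1, v1 * c0 * a:] \<and>
        H $ 1 = subst1 g (Const3 a * varY + subst1 b varX) \<and>
        H $ 2 = Const3 v1 * varZ
                - Const3 (inverse a) * subst1 (pderiv b) varX
                    * subst1 g (Const3 a * varY + subst1 b varX)
                - Const3 (v1 * l2) * varX \<and>
        H $ 3 = Const3 c0 * (H $ 1)\<^sup>2 + Const3 l2 * H $ 1)"

definition form_B :: "('a::field poly3)^3 \<Rightarrow> bool" where
  "form_B H \<longleftrightarrow>
     (\<exists>u1 c0 a l1 l2 l2' :: 'a. \<exists>g b :: 'a poly.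
        u1 \<noteq> 0 \<and> c0 \<noteq> 0 \<and> a \<noteq> 0 \<and> poly g 0 = 0 \<and> degree g \<ge> 1 \<and>
        b = [:l2', l1, u1 * c0 * a:] \<and>
        H $ 1 = Const3 u1 * varZ
                - Const3 (inverse a) * subst1 (pderiv b) varY
                    * subst1 g (Const3 a * varX + subst1 b varY)
                - Const3 (u1 * l2) * varY \<and>
        H $ 2 = subst1 g (Const3 a * varX + subst1 b varY) \<and>
        H $ 3 = Const3 c0 * (H $ 2)\<^sup>2 + Const3 l2 * H $ 2)"

end

theory Submission
  imports Defs
begin

text \<open>
  Nilpotency means that the trace, the sum of the principal \<open>2 \<times> 2\<close> minors and the
  determinant of \<open>JH\<close> vanish. If \<open>u\<close> does not involve \<open>z\<close>, comparing coefficients in \<open>z\<close> gives \<open>v = v\<^sub>0 + v\<^sub>1 z\<close> with a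
  constant \<open>v\<^sub>1\<close>, and \<open>u\<close>, \<open>v\<^sub>0\<close>, \<open>h\<close> satisfy equations which force every level curve of \<open>u\<close>, at a point where
  \<open>u\<^sub>y \<noteq> 0\<close>, to be a parabola \<open>y = Y(x)\<close> with \<open>degree Y \<le> 2\<close>: along the curve, the derivatives of
  \<open>u(x, Y(x))\<close> satisfy a homogeneous linear system of differential equations. Two such parabolas on
  which \<open>u\<close> takes different values do not meet, so over an algebraically closed field they differ by
  a constant. Hence \<open>u = g(y + b(x))\<close> with \<open>b\<close> quadratic, and \<open>v\<^sub>0\<close> and \<open>h\<close> are found by integration.
  The same argument with \<open>h = 0\<close> classifies nilpotent Jacobians in dimension two.

  The second case follows by exchanging \<open>x\<close> and \<open>y\<close>. In the third case one shows that \<open>u\<close> has degree one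
  in \<open>z\<close> and that \<open>u\<^sub>z = l v\<^sub>z\<close> for a constant \<open>l\<close>; conjugating with \<open>x \<mapsto> x + l y\<close> leads back to the
  first case.
\<close>

section \<open>Derivations on polynomials\<close>

lemma coeff_map_poly_additive:
  fixes \<delta> :: "'r::comm_ring_1 \<Rightarrow> 'r"
  assumes "\<And>a b. \<delta> (a + b) = \<delta> a + \<delta> b"
  shows "coeff (map_poly \<delta> p) n = \<delta> (coeff p n)"
proof -
  have "\<delta> 0 = 0" using assms[of 0 0] by simp
  then show ?thesis by (rule coeff_map_poly)
qed

lemma map_poly_leibniz:
  fixes \<delta> :: "'r::comm_ring_1 \<Rightarrow> 'r"
  assumes add: "\<And>a b. \<delta> (a + b) = \<delta> a + \<delta> b"
    and mult: "\<And>a b. \<delta> (a * b) = a * \<delta> b + \<delta> a * b"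
  shows "map_poly \<delta> (p * q) = p * map_poly \<delta> q + map_poly \<delta> p * q"
proof (rule poly_eqI)
  fix n
  have zero: "\<delta> 0 = 0" using add[of 0 0] by simp
  have "\<delta> (\<Sum>i\<in>A. f i) = (\<Sum>i\<in>A. \<delta> (f i))" for f and A :: "nat set"
    by (induction A rule: infinite_finite_induct) (auto simp: add zero)
  then show "coeff (map_poly \<delta> (p * q)) n = coeff (p * map_poly \<delta> q + map_poly \<delta> p * q) n"
    by (simp add: coeff_map_poly_additive[of \<delta>, OF add] coeff_mult mult sum.distrib)
qed

text \<open>In K[x][y] the outer variable is y, so d/dx acts on coefficients while d/dy is
  \<open>pderiv\<close>.\<close>

definition dx :: "'a::idom poly poly \<Rightarrow> 'a poly poly" where
  "dx = map_poly pderiv"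

abbreviation dy :: "'a::idom poly poly \<Rightarrow> 'a poly poly" where
  "dy \<equiv> pderiv"

lemma coeff_dx: "coeff (dx p) n = pderiv (coeff p n)"
  unfolding dx_def by (simp add: coeff_map_poly)

lemma dx_0 [simp]: "dx 0 = 0"
  by (simp add: dx_def)

lemma dx_pCons: "dx (pCons a p) = pCons (pderiv a) (dx p)"
  by (rule poly_eqI) (simp add: coeff_dx coeff_pCons split: nat.split)

lemma dx_add: "dx (p + q) = dx p + dx q"
  by (rule poly_eqI) (simp add: coeff_dx pderiv_add)

lemma dx_minus: "dx (- p) = - dx p"
  by (rule poly_eqI) (simp add: coeff_dx pderiv_minus)

lemma dx_diff: "dx (p - q) = dx p - dx q"
  by (rule poly_eqI) (simp add: coeff_dx pderiv_diff)

lemma dx_mult: "dx (p * q) = p * dx q + dx p * q"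
  unfolding dx_def by (rule map_poly_leibniz) (simp_all add: pderiv_add pderiv_mult mult.commute)

lemma dx_dy: "dx (dy p) = dy (dx p)"
  by (rule poly_eqI) (simp add: coeff_dx coeff_pderiv pderiv_mult del: of_nat_Suc)

lemma dx_power2: "dx (p\<^sup>2) = 2 * p * dx p"
  by (simp add: power2_eq_square dx_mult)

lemma dy_power2: "dy (p\<^sup>2) = 2 * p * dy p" for p :: "'a::idom poly poly"
  by (simp add: power2_eq_square pderiv_mult)

text \<open>Chain rule along the graph y = Y(x): \<open>poly p Y\<close> is the one-variable
  polynomial p(x, Y(x)).\<close>

lemma pderiv_poly_curve:
  "pderiv (poly p Y) = poly (dx p) Y + poly (dy p) Y * pderiv Y"
  by (induction p) (auto simp: dx_pCons pderiv_pCons pderiv_add pderiv_mult algebra_simps)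

lemma dx_eq_0D:
  fixes p :: "'a::field_char_0 poly poly"
  assumes "dx p = 0" "dy p = 0"
  obtains c where "p = [:[:c:]:]"
proof -
  obtain r where r: "p = [:r:]" using assms(2) pderiv_iszero by blast
  then have "pderiv r = 0" using assms(1) by (simp add: dx_pCons)
  then obtain c where "r = [:c:]" using pderiv_iszero by blast
  with r that show ?thesis by simp
qed

section \<open>The level curves are parabolas\<close>

text \<open>Polynomial form of uniqueness for a linear ODE system with zero initial data. As
  \<open>a\<close> does not vanish at \<open>x0\<close>, a power of x - x0 dividing \<open>p\<close>
  and \<open>r\<close> also divides their derivatives; in characteristic 0 this raises the order of
  vanishing by one.\<close>

lemma linear_system_power_dvd:
  fixes p r a c1 c2 c3 c4 :: "'a::field_char_0 poly"
  assumes p': "a * pderiv p = c1 * p + c2 * r"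
    and r': "a * pderiv r = c3 * p + c4 * r"
    and a: "poly a x0 \<noteq> 0" and p0: "poly p x0 = 0" and r0: "poly r x0 = 0"
  shows "[:- x0, 1:] ^ Suc k dvd p \<and> [:- x0, 1:] ^ Suc k dvd r"
proof (induction k)
  case 0
  show ?case using p0 r0 by (simp add: poly_eq_0_iff_dvd)
next
  case (Suc k)
  define s where "s = [:- x0, 1:]"
  have cancel: "s ^ n dvd f" if "s ^ n dvd a * f" for n f
  proof (cases "f = 0")
    case False
    then have "order x0 (a * f) = order x0 f"
      using a by (subst order_mult) (auto simp: order_0I)
    then show ?thesis using that a False unfolding s_def order_divides by auto
  qed simp
  have s': "pderiv s = 1" by (simp add: s_def pderiv_pCons)
  have step: "s ^ Suc (Suc k) dvd f" if f: "s ^ Suc k dvd f" and af: "s ^ Suc k dvd a * pderiv f" for f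
  proof -
    obtain g where g: "f = s ^ Suc k * g" using f by (elim dvdE)
    have "s ^ Suc k dvd pderiv f"
      using af by (rule cancel)
    moreover have "pderiv f = s ^ Suc k * pderiv g + s ^ k * smult (of_nat (Suc k)) g"
      unfolding g by (simp add: pderiv_mult pderiv_power_Suc s' mult_ac del: power_Suc of_nat_Suc)
    ultimately have "s ^ Suc k dvd s ^ k * smult (of_nat (Suc k)) g"
      by (simp add: dvd_add_right_iff del: power_Suc of_nat_Suc)
    then have "s ^ k * s dvd s ^ k * smult (of_nat (Suc k)) g" by (simp only: power_Suc2)
    moreover have "s ^ k \<noteq> 0" by (simp add: s_def)
    ultimately have "s dvd smult (of_nat (Suc k)) g" by (simp only: dvd_mult_cancel_left) simp
    then have "s dvd g" by (simp add: dvd_smult_iff del: of_nat_Suc)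
    then show ?thesis unfolding g by (subst power_Suc2) (rule mult_dvd_mono, auto)
  qed
  show ?case using Suc.IH step[of p] step[of r] p' r' unfolding s_def by auto
qed

lemma linear_system_eq_0:
  fixes p r a c1 c2 c3 c4 :: "'a::field_char_0 poly"
  assumes "a * pderiv p = c1 * p + c2 * r" "a * pderiv r = c3 * p + c4 * r"
    and "poly a x0 \<noteq> 0" "poly p x0 = 0" "poly r x0 = 0"
  shows "p = 0"
proof (rule ccontr)
  assume "p \<noteq> 0"
  moreover have "[:- x0, 1:] ^ Suc (degree p) dvd p"
    using linear_system_power_dvd[OF assms] by blast
  ultimately have "degree ([:- x0, 1:] ^ Suc (degree p)) \<le> degree p"
    by (rule dvd_imp_degree_le[rotated])
  then show False by (simp add: degree_linear_power del: power_Suc)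
qed

text \<open>Determinant, trace and principal minors for a map (u, q + z, h) whose \<open>u\<close>,
  \<open>q\<close> and \<open>h\<close> are free of z. With h = 0 the equations describe nilpotent
  Jacobians in the plane.\<close>

locale level_curves =
  fixes u q h :: "'a::{alg_closed_field, field_char_0} poly poly"
  assumes jac: "dx u * dy h = dy u * dx h"
    and qy: "dy q = - dx u"
    and minor: "(dx u)\<^sup>2 + dy u * dx q + dy h = 0"
begin

definition N where "N = dy (dy h) * dy u - dy h * dy (dy u)"

text \<open>The right side is the numerator from implicit differentiation: a level curve y(x) of
  \<open>u\<close> has y'' = -N / (dy u)^3. It arises by differentiating \<open>minor\<close> in y
  and eliminating \<open>dx q\<close>.\<close>

lemma N_eq: "N = dx (dx u) * (dy u)\<^sup>2 - 2 * dx u * dy (dx u) * dy u + (dx u)\<^sup>2 * dy (dy u)"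
proof -
  have "dy ((dx u)\<^sup>2 + dy u * dx q + dy h) = 0" using minor by simp
  moreover have "dy (dx q) = - dx (dx u)" using qy by (metis dx_dy dx_minus)
  ultimately have "2 * dx u * dy (dx u) + dy (dy u) * dx q - dy u * dx (dx u) + dy (dy h) = 0"
    by (simp add: pderiv_add pderiv_mult dy_power2 algebra_simps)
  with minor show ?thesis unfolding N_def by algebra
qed

text \<open>N / (dy u)^3 is constant along level curves of \<open>u\<close>: if h = phi(u), it
  equals phi''(u). Algebraically this follows from \<open>jac\<close> and its first two
  y-derivatives.\<close>

lemma N_invariant:
  "dy u * (dy u * dx N - dx u * dy N) = 3 * N * (dy u * dy (dx u) - dx u * dy (dy u))"
proof -
  have J1: "dy (dx u) * dy h + dx u * dy (dy h) = dy (dy u) * dx h + dy u * dy (dx h)"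
    using arg_cong[OF jac, of dy] by (simp add: pderiv_mult algebra_simps)
  have J2: "dy (dy (dx u)) * dy h + 2 * dy (dx u) * dy (dy h) + dx u * dy (dy (dy h))
      = dy (dy (dy u)) * dx h + 2 * dy (dy u) * dy (dx h) + dy u * dy (dy (dx h))"
    using arg_cong[OF J1, of dy] by (simp add: pderiv_mult pderiv_add algebra_simps)
  have Nx: "dx N = dy (dy (dx h)) * dy u + dy (dy h) * dy (dx u)
      - dy (dx h) * dy (dy u) - dy h * dy (dy (dx u))"
    unfolding N_def by (simp add: dx_diff dx_mult dx_dy algebra_simps)
  have Ny: "dy N = dy (dy (dy h)) * dy u - dy h * dy (dy (dy u))"
    unfolding N_def by (simp add: pderiv_diff pderiv_mult algebra_simps)
  show ?thesis using jac J1 J2 unfolding Nx Ny unfolding N_def by algebra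
qed

text \<open>The candidate is the second-order Taylor polynomial of the level curve at (x0, t). The
  derivative \<open>w\<close> of u along it and the defect \<open>r\<close> of its second derivative
  solve a homogeneous linear system with zero initial values, so w = 0.\<close>

lemma parabola_through_point:
  assumes "poly (poly (dy u) [:t:]) x0 \<noteq> 0"
  obtains Y where "degree Y \<le> 2" "poly Y x0 = t" "poly u Y = [:poly (poly u [:t:]) x0:]"
proof -
  define v where "v f = poly (poly f [:t:]) x0" for f :: "'a poly poly"
  \<comment> \<open>Slope and second derivative that implicit differentiation predicts for the level
    curve at the point.\<close>
  define m0 n0 where "m0 = - v (dx u) / v (dy u)" and "n0 = - v N / v (dy u) ^ 3"
  define s where "s = [:- x0, 1:]"
  define Y where "Y = [:t:] + smult m0 s + smult (n0 / 2) (s\<^sup>2)"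
  define e where "e f = poly f Y" for f :: "'a poly poly"
  have s': "pderiv s = 1" and s0: "poly s x0 = 0" by (auto simp: s_def pderiv_pCons)
  have Y': "pderiv Y = [:m0:] + smult n0 s"
  proof -
    have "2 * s = smult 2 s" by (rule poly_eqI) (simp only: coeff_add coeff_smult mult_2)
    then show ?thesis
      by (simp add: Y_def pderiv_add pderiv_smult power2_eq_square pderiv_mult s')
  qed
  have Y'': "pderiv (pderiv Y) = [:n0:]"
    by (simp add: Y' pderiv_add pderiv_smult s')
  have Y0: "poly Y x0 = t" by (simp add: Y_def s0)
  have ev: "poly (e f) x0 = v f" for f
    unfolding e_def v_def by (induction f) (auto simp: Y0)
  have e_simps: "e (f + g) = e f + e g" "e (f * g) = e f * e g" "e (f - g) = e f - e g" "e (- f) = - e f"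
      "e (f ^ n) = e f ^ n" "e (numeral k) = numeral k" for f g n k
    by (simp_all add: e_def numeral_poly)
  have e': "pderiv (e f) = e (dx f) + e (dy f) * pderiv Y" for f
    unfolding e_def by (rule pderiv_poly_curve)
  define w where "w = pderiv (e u)"
  define a where "a = e (dy u)"
  \<comment> \<open>\<open>r\<close> measures how far Y'' = n0 is from -N / (dy u)^3 along the
    curve, with the denominator cleared.\<close>
  define r where "r = e N + [:n0:] * a ^ 3"
  define \<alpha> where "\<alpha> = 2 * a * e (dy (dx u)) + e (dy (dy u)) * w - 2 * e (dy (dy u)) * e (dx u)"
  define \<beta> where "\<beta> = a * e (dy N) + 3 * [:n0:] * a ^ 3 * e (dy (dy u))"
  define \<epsilon> where "\<epsilon> = a * e (dy (dx u)) - e (dx u) * e (dy (dy u))"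
  have a': "pderiv a = e (dy (dx u)) + e (dy (dy u)) * pderiv Y"
    by (simp add: a_def e' dx_dy)
  have w: "w = e (dx u) + a * pderiv Y" by (simp add: w_def a_def e')
  have w': "pderiv w = e (dx (dx u)) + 2 * e (dy (dx u)) * pderiv Y + e (dy (dy u)) * (pderiv Y)\<^sup>2
      + a * [:n0:]"
    by (simp only: w pderiv_add pderiv_mult e' a' Y'')
      (simp add: algebra_simps power2_eq_square)
  have r': "pderiv r = e (dx N) + e (dy N) * pderiv Y + 3 * [:n0:] * a\<^sup>2 * pderiv a"
    by (simp only: r_def pderiv_add pderiv_mult e' power3_eq_cube pderiv_singleton) algebra
  have I1: "e N = e (dx (dx u)) * a\<^sup>2 - 2 * e (dx u) * e (dy (dx u)) * a + (e (dx u))\<^sup>2 * e (dy (dy u))"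
    using arg_cong[OF N_eq, of e] by (simp only: e_simps a_def)
  have I2: "a * (a * e (dx N) - e (dx u) * e (dy N)) = 3 * e N * \<epsilon>"
    using arg_cong[OF N_invariant, of e] by (simp only: e_simps a_def \<epsilon>_def)
  \<comment> \<open>The formula \<open>w = e (dx u) + a * pderiv Y\<close> lets Y' be traded for
    \<open>w\<close>; \<open>N_eq\<close> then supplies the first equation and
    \<open>N_invariant\<close> the second.\<close>
  have sys1: "a\<^sup>2 * pderiv w = \<alpha> * w + 1 * r"
    using w I1 unfolding w' r_def \<alpha>_def by algebra
  have sys2: "a\<^sup>2 * pderiv r = \<beta> * w + (3 * \<epsilon>) * r"
    using w I2 unfolding r' a' unfolding r_def \<beta>_def \<epsilon>_def by algebra
  have v0: "v (dy u) \<noteq> 0" using assms by (simp add: v_def)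
  have "w = 0"
  proof (rule linear_system_eq_0[OF sys1 sys2])
    show "poly (a\<^sup>2) x0 \<noteq> 0" using v0 by (simp add: a_def ev)
    show "poly w x0 = 0" using v0 by (simp add: w a_def ev Y' s0 m0_def)
    show "poly r x0 = 0" using v0 by (simp add: r_def a_def ev n0_def)
  qed
  then obtain c where c: "e u = [:c:]" unfolding w_def using pderiv_iszero by blast
  moreover have "c = v u" using ev[of u] c by simp
  moreover have "degree Y \<le> 2"
    unfolding Y_def by (intro degree_add_le order.trans[OF degree_smult_le])
      (auto simp: s_def power2_eq_square)
  ultimately show ?thesis using Y0 that by (simp add: e_def v_def)
qed

end

section \<open>Straightening all level curves at once\<close>

definition const_y :: "'a::idom poly \<Rightarrow> 'a poly poly" where
  "const_y = map_poly (\<lambda>c. [:c:])"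

lemma coeff_const_y: "coeff (const_y p) n = [:coeff p n:]"
  by (simp add: const_y_def coeff_map_poly)

lemma poly_const_y: "poly (const_y p) [:t:] = [:poly p t:]"
  by (simp add: const_y_def flip: pcompose_altdef pcompose_pCons_0)

lemma dx_const_y [simp]: "dx (const_y p) = 0"
  by (rule poly_eqI) (simp add: coeff_dx coeff_const_y)

lemma const_y_pcompose_shift:
  fixes p :: "'a::idom poly"
  shows "const_y (pcompose p [:c, 1:]) = pcompose (const_y p) [:[:c:], 1:]"
proof -
  have mult: "const_y (p * q) = const_y p * const_y q" for p q :: "'a poly"
    unfolding const_y_def
    by (rule poly_eqI) (simp add: coeff_map_poly coeff_mult sum_to_poly mult.commute)
  have add: "const_y (p + q) = const_y p + const_y q" for p q :: "'a poly"
    by (rule poly_eqI) (simp add: coeff_const_y)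
  have pCons: "const_y (pCons a p) = pCons [:a:] (const_y p)" for a and p :: "'a poly"
    by (simp add: const_y_def map_poly_pCons)
  have lin: "const_y 1 = (1 :: 'a poly poly)" "const_y 0 = (0 :: 'a poly poly)"
    by (simp_all add: const_y_def)
  show ?thesis
    by (induction p) (simp_all only: pcompose_pCons pcompose_0 add mult pCons lin pCons_one)
qed

lemma dx_pcompose:
  "dx (pcompose p q) = pcompose (dx p) q + pcompose (dy p) q * dx q"
  by (induction p)
    (auto simp: pcompose_pCons dx_pCons dx_add dx_mult pderiv_pCons pcompose_add algebra_simps)

lemma poly_map_poly_eval: "poly (map_poly (\<lambda>c. poly c x0) p) t = poly (poly p [:t:]) x0"
  by (induction p) (auto simp: map_poly_pCons)

lemma pderiv_map_poly_eval:
  fixes p :: "'a::idom poly poly"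
  shows "pderiv (map_poly (\<lambda>c. poly c x0) p) = map_poly (\<lambda>c. poly c x0) (dy p)"
  by (rule poly_eqI) (simp add: coeff_map_poly coeff_pderiv poly_of_nat del: of_nat_Suc)

context level_curves
begin

text \<open>The parabolas through the points (x0, t) are vertical translates of one curve y = S(x),
  so shifting y by \<open>S\<close> removes x from \<open>u\<close>.\<close>

lemma parabola_pencil:
  assumes uy: "dy u \<noteq> 0"
  obtains S U where "degree S \<le> 2" "pcompose u [:S, 1:] = const_y U"
proof -
  \<comment> \<open>On the line x = x0 the leading y-coefficient of \<open>dy u\<close> survives, so
    u(x0, y) is not constant and only finitely many t are excluded below.\<close>
  obtain x0 where x0: "poly (lead_coeff (dy u)) x0 \<noteq> 0"
    using uy poly_all_0_iff_0 leading_coeff_0_iff by blast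
  define U where "U = map_poly (\<lambda>c. poly c x0) u"
  have U: "poly U t = poly (poly u [:t:]) x0" for t
    by (simp add: U_def poly_map_poly_eval)
  have U': "poly (pderiv U) t = poly (poly (dy u) [:t:]) x0" for t
    by (simp add: U_def pderiv_map_poly_eval poly_map_poly_eval)
  have "coeff (pderiv U) (degree (dy u)) \<noteq> 0"
    using x0 by (simp add: U_def pderiv_map_poly_eval coeff_map_poly)
  then have dU: "pderiv U \<noteq> 0" by force
  define G where "G = {t. poly (pderiv U) t \<noteq> 0}"
  have "finite {t. poly (pderiv U) t = 0}" using dU by (rule poly_roots_finite)
  moreover have "G = UNIV - {t. poly (pderiv U) t = 0}" by (auto simp: G_def)
  ultimately have G: "infinite G" by (simp add: Diff_infinite_finite infinite_UNIV_char_0)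
  have "\<exists>Y. degree Y \<le> 2 \<and> poly Y x0 = t \<and> poly u Y = [:poly U t:]" if "t \<in> G" for t
    using parabola_through_point[of t x0] that U U' unfolding G_def by (metis mem_Collect_eq)
  then obtain Y where Y: "degree (Y t) \<le> 2" "poly (Y t) x0 = t" "poly u (Y t) = [:poly U t:]"
    if "t \<in> G" for t by metis
  \<comment> \<open>Curves on which u takes different values cannot meet. Over an algebraically
    closed field their difference is then constant, and its value at \<open>x0\<close> is s -
    t.\<close>
  have disjoint: "Y s - [:s:] = Y t - [:t:]" if st: "s \<in> G" "t \<in> G" and ne: "poly U s \<noteq> poly U t" for s t
  proof -
    have "poly (Y s - Y t) r \<noteq> 0" for r
    proof
      assume r: "poly (Y s - Y t) r = 0"
      have "poly (poly u (Y z)) r = poly (poly u [:poly (Y z) r:]) r" for z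
        by (induction u) auto
      then have "poly (poly u (Y s)) r = poly (poly u (Y t)) r" using r by simp
      then show False using ne Y(3) st by simp
    qed
    then have "degree (Y s - Y t) = 0" using alg_closed_imp_poly_has_root by blast
    then obtain c where c: "Y s - Y t = [:c:]" by (meson degree_eq_zeroE)
    moreover have "c = s - t" using arg_cong[OF c, of "\<lambda>p. poly p x0"] Y(2) st by simp
    ultimately show ?thesis by (simp add: algebra_simps)
  qed
  have translate: "Y s - [:s:] = Y t - [:t:]" if st: "s \<in> G" "t \<in> G" for s t
  proof -
    have fin: "finite {z. poly U z = c}" for c
    proof -
      have "U - [:c:] \<noteq> 0" using dU by auto
      then have "finite {z. poly (U - [:c:]) z = 0}" by (rule poly_roots_finite)
      then show ?thesis by simp
    qed
    \<comment> \<open>\<open>s\<close> and \<open>t\<close> may lie on the same level, so both are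
      compared with a third point \<open>z\<close> on another level; fibres of \<open>U\<close> are
      finite and \<open>G\<close> is infinite.\<close>
    have "infinite (G - ({z. poly U z = poly U s} \<union> {z. poly U z = poly U t}))"
      using G fin by (intro Diff_infinite_finite) auto
    then obtain z where z: "z \<in> G - ({z. poly U z = poly U s} \<union> {z. poly U z = poly U t})"
      by (metis finite.emptyI ex_in_conv)
    then have "Y s - [:s:] = Y z - [:z:]" "Y t - [:t:] = Y z - [:z:]"
      using st by (auto intro!: disjoint)
    then show ?thesis by simp
  qed
  obtain t0 where t0: "t0 \<in> G" using G by (metis finite.emptyI ex_in_conv)
  define S where "S = Y t0 - [:t0:]"
  \<comment> \<open>As a polynomial in y over K[x], the difference has infinitely many roots t in
    K.\<close>
  have "poly (pcompose u [:S, 1:] - const_y U) [:t:] = 0" if t: "t \<in> G" for t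
  proof -
    have "[:t:] + S = Y t" using translate[OF t t0] by (simp add: S_def algebra_simps)
    then show ?thesis using Y(3)[OF t]
      by (simp add: poly_pcompose poly_const_y add.commute)
  qed
  then have "(\<lambda>t. [:t:]) ` G \<subseteq> {z. poly (pcompose u [:S, 1:] - const_y U) z = 0}" by auto
  moreover have "infinite ((\<lambda>t. [:t:]) ` G)" using G by (subst finite_image_iff) (auto simp: inj_on_def)
  ultimately have "pcompose u [:S, 1:] - const_y U = 0"
    using poly_roots_finite finite_subset by blast
  moreover have "degree S \<le> 2" using Y(1)[OF t0] unfolding S_def by (intro degree_diff_le) auto
  ultimately show ?thesis using that by simp
qed

text \<open>Undoing the shift gives u = U(y - S(x)); the constant S(0) is absorbed into
  \<open>g\<close>, so that the quadratic vanishes at 0.\<close>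

lemma straightened_form:
  assumes uy: "dy u \<noteq> 0"
  obtains b1 b2 g where "u = pcompose (const_y g) [:[:0, b1, b2:], 1:]"
proof -
  obtain S U where S: "degree S \<le> 2" and U: "pcompose u [:S, 1:] = const_y U"
    using parabola_pencil[OF uy] .
  define s0 where "s0 = poly S 0"
  define b where "b = [:s0:] - S"
  have "coeff b n = 0" if "n > 2" for n
    using that S by (auto simp: b_def coeff_eq_0 coeff_pCons split: nat.split)
  moreover have "coeff b 0 = 0" by (simp add: b_def s0_def poly_0_coeff_0)
  ultimately have b_eq: "b = [:0, coeff b 1, coeff b 2:]"
    by (intro poly_eqI) (auto simp: coeff_pCons numeral_2_eq_2 split: nat.split)
  have "u = pcompose (const_y (pcompose U [:- s0, 1:])) [:b, 1:]"
  proof -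
    have "u = pcompose (pcompose u [:S, 1:]) [:- S, 1:]"
      by (simp add: pcompose_pCons flip: pcompose_assoc)
    also have "[:- S, 1:] = pcompose [:[:- s0:], 1:] [:b, 1:]"
      by (simp add: pcompose_pCons b_def)
    finally show ?thesis by (simp add: U const_y_pcompose_shift flip: pcompose_assoc)
  qed
  then have "u = pcompose (const_y (pcompose U [:- s0, 1:])) [:[:0, coeff b 1, coeff b 2:], 1:]"
    by (subst b_eq[symmetric])
  then show ?thesis by (rule that)
qed

text \<open>Integration of the equations with u = g(y + b(x)), where u_x = b' u_y: the trace yields
  q = -b' u + r(x), the minor equation gives h_y, and equality of the mixed derivatives of h makes r
  affine.\<close>

lemma normal_form:
  assumes uy: "dy u \<noteq> 0"
  obtains g b1 b2 \<rho> r0 c where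
    "u = pcompose (const_y g) [:[:0, b1, b2:], 1:]"
    "q = - ([:pderiv [:0, b1, b2:]:] * u) + [:[:r0, \<rho>:]:]"
    "h = [:[:b2:]:] * u\<^sup>2 - [:[:\<rho>:]:] * u + [:[:c:]:]"
proof -
  obtain b1 b2 g where u: "u = pcompose (const_y g) [:[:0, b1, b2:], 1:]"
    using straightened_form[OF uy] .
  define B where "B = [:pderiv [:0, b1, b2:]:]"
  define C where "C = [:[:2 * b2:]:]"
  have B': "dx B = C" "dy B = 0" by (auto simp: B_def C_def pderiv_pCons dx_pCons)
  have C': "dx C = 0" "dy C = 0" by (auto simp: C_def dx_pCons)
  have ux: "dx u = B * dy u"
    unfolding u by (simp add: dx_pcompose pderiv_pcompose B_def dx_pCons pderiv_pCons)
  have "dy (q + B * u) = 0" by (simp add: pderiv_add pderiv_mult B' qy ux)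
  then obtain r where r: "q + B * u = [:r:]" using pderiv_iszero by blast
  then have q: "q = - (B * u) + [:r:]" by (simp add: algebra_simps)
  define r' where "r' = [:pderiv r:]"
  have r'y: "dy r' = 0" by (simp add: r'_def)
  have qx: "dx q = - (C * u) - B * dx u + r'"
    unfolding q by (simp add: dx_add dx_minus dx_diff dx_mult B' r'_def dx_pCons)
  have hy: "dy h = dy u * (C * u - r')" using minor ux unfolding qx by algebra
  have hx: "dx h = B * dy h" 
  proof -
    have "dy u * (dx h - B * dy h) = 0" using jac ux by algebra
    then show ?thesis using uy by simp
  qed
  have "dx (dy h) = dy (B * dy h)" by (simp add: dx_dy hx)
  moreover have "dx (dy u) = B * dy (dy u)" by (simp add: dx_dy ux pderiv_mult B')
  ultimately have "dy u * dx r' = 0"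
    unfolding hy by (simp add: dx_mult dx_diff pderiv_mult pderiv_diff B' C' r'y ux algebra_simps)
  then have "pderiv (pderiv r) = 0" using uy by (simp add: r'_def dx_pCons)
  then obtain \<rho> where "pderiv r = [:\<rho>:]" using pderiv_iszero by blast
  then have \<rho>: "pderiv (r - [:0, \<rho>:]) = 0" by (simp add: pderiv_diff pderiv_pCons)
  then obtain r0 where "r - [:0, \<rho>:] = [:r0:]" using pderiv_iszero by blast
  then have r_eq: "r = [:r0, \<rho>:]" by (simp add: algebra_simps)
  \<comment> \<open>The difference between \<open>h\<close> and the expected quadratic in
    \<open>u\<close>; both of its partial derivatives vanish.\<close>
  define k where "k = h - [:[:b2:]:] * u\<^sup>2 + [:[:\<rho>:]:] * u"
  have r'_eq: "r' = [:[:\<rho>:]:]" by (simp add: r'_def r_eq pderiv_pCons)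
  have C2: "C = 2 * [:[:b2:]:]" by (simp add: C_def numeral_poly)
  have ky: "dy k = 0"
    unfolding k_def pderiv_add pderiv_diff hy pderiv_mult[of "[:_:]"] dy_power2 C2 r'_eq
    by (simp only: pderiv_singleton) algebra
  have "dx k = B * dy k"
    unfolding k_def pderiv_add pderiv_diff dx_add dx_diff hx pderiv_mult[of "[:_:]"]
      dx_mult[of "[:_:]"] dy_power2 dx_power2 ux
    by (simp add: dx_pCons algebra_simps)
  then have "dx k = 0" using ky by simp
  then obtain c where "k = [:[:c:]:]" using ky dx_eq_0D by blast
  then have "h = [:[:b2:]:] * u\<^sup>2 - [:[:\<rho>:]:] * u + [:[:c:]:]"
    by (simp add: k_def algebra_simps)
  moreover have "q = - ([:pderiv [:0, b1, b2:]:] * u) + [:[:r0, \<rho>:]:]"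
    using q unfolding r_eq B_def .
  ultimately show ?thesis using u that by blast
qed

end

section \<open>Maps with first and third component free of \<open>z\<close>\<close>

lemma coeff_diff_x: "coeff (diff_x p) k = dx (coeff p k)"
  by (simp add: diff_x_def coeff_map_poly dx_def)

lemma coeff_diff_y: "coeff (diff_y p) k = dy (coeff p k)"
  by (simp add: diff_y_def coeff_map_poly)

lemma coeff_diff_z: "coeff (diff_z p) k = of_nat (Suc k) * coeff p (Suc k)"
  by (simp add: diff_z_def coeff_pderiv)

lemma diff_const [simp]: "diff_x [:u:] = [:dx u:]" "diff_y [:u:] = [:dy u:]" "diff_z [:u:] = 0"
  by (auto intro!: poly_eqI simp: coeff_diff_x coeff_diff_y coeff_pCons diff_z_def split: nat.split)

lemma subst1_pCons: "subst1 (pCons a p) t = Const3 a + t * subst1 p t"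
  by (simp add: subst1_def map_poly_pCons Const3_def)

lemma subst1_0 [simp]: "subst1 0 t = 0"
  by (simp add: subst1_def)

lemma subst1_varX: "subst1 p varX = [:[:p:]:]"
  by (induction p) (auto simp: subst1_pCons Const3_def varX_def)

lemma subst1_const_z: "subst1 g [:w:] = [:pcompose (const_y g) w:]"
proof (induction g)
  case 0
  then show ?case by (simp add: const_y_def)
next
  case (pCons a g)
  have "const_y (pCons a g) = pCons [:a:] (const_y g)"
    by (simp add: const_y_def map_poly_pCons)
  with pCons show ?case by (simp add: subst1_pCons Const3_def pcompose_pCons)
qed

text \<open>The three equations are the vanishing of the trace, of the sum of the principal
  \<open>2 \<times> 2\<close> minors and of the determinant of the Jacobian of \<open>(U, V, W)\<close>.\<close>

definition nilp_equations :: "'a::idom poly3 \<Rightarrow> 'a poly3 \<Rightarrow> 'a poly3 \<Rightarrow> bool" where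
  "nilp_equations U V W \<longleftrightarrow>
     diff_x U + diff_y V = 0 \<and>
     diff_x U * diff_y V - diff_y U * diff_x V - diff_z U * diff_x W - diff_z V * diff_y W = 0 \<and>
     diff_z V * (diff_x W * diff_y U - diff_y W * diff_x U)
       = diff_z U * (diff_x W * diff_y V - diff_y W * diff_x V)"

definition indep3 :: "'a::comm_ring_1 poly3 \<Rightarrow> 'a poly3 \<Rightarrow> 'a poly3 \<Rightarrow> bool" where
  "indep3 U V W \<longleftrightarrow> (\<forall>a b c. Const3 a * U + Const3 b * V + Const3 c * W = 0 \<longrightarrow> a = 0 \<and> b = 0 \<and> c = 0)"

lemma indep3D:
  "indep3 U V W \<Longrightarrow> Const3 a * U + Const3 b * V + Const3 c * W = 0 \<Longrightarrow> a = 0 \<and> b = 0 \<and> c = 0"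
  by (auto simp: indep3_def)

abbreviation (input) at0 :: "'a::comm_ring_1 poly3 \<Rightarrow> 'a" where
  "at0 p \<equiv> eval3 p 0 0 0"

text \<open>The case h = 0 of \<open>normal_form\<close>: differentiating 0 = b2 u^2 - rho u + c
  twice in y, with \<open>dy u\<close> nonzero, forces b2 = rho = 0, so v is affine in u. If
  \<open>dy u = 0\<close>, the determinant gives (dx u)^2 = 0.\<close>

lemma nilp_imp_dependent:
  fixes u v :: "'a::{alg_closed_field, field_char_0} poly poly"
  assumes tr: "dx u + dy v = 0" and jac: "dx u * dy v = dy u * dx v"
  shows "dy u = 0 \<and> dx u = 0 \<and> dy v = 0 \<or>
    (\<exists>b c. v = [:[:b:]:] * u + [:[:c:]:] \<and> dx u = - [:[:b:]:] * dy u \<and> dy u \<noteq> 0)"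
proof (cases "dy u = 0")
  case True
  then have "dx u * dx u = 0" using tr jac by algebra
  then show ?thesis using True tr by simp
next
  case False
  have vy: "dy v = - dx u" using tr by (simp add: eq_neg_iff_add_eq_0 add.commute)
  interpret level_curves u v 0
  proof
    show "(dx u)\<^sup>2 + dy u * dx v + dy 0 = 0" using jac vy by (simp add: power2_eq_square flip: jac)
  qed (simp_all add: vy)
  obtain g b1 b2 \<rho> r0 c where u: "u = pcompose (const_y g) [:[:0, b1, b2:], 1:]"
    and v: "v = - ([:pderiv [:0, b1, b2:]:] * u) + [:[:r0, \<rho>:]:]"
    and z: "0 = [:[:b2:]:] * u\<^sup>2 - [:[:\<rho>:]:] * u + [:[:c:]:]"
    using normal_form[OF False] by metis
  have "dy u * (2 * [:[:b2:]:] * u - [:[:\<rho>:]:]) = 0"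
    using arg_cong[OF z, of dy]
    unfolding pderiv_add pderiv_diff pderiv_mult[of "[:_:]"] dy_power2 pderiv_singleton pderiv_0
    by algebra
  then have z1: "2 * [:[:b2:]:] * u - [:[:\<rho>:]:] = 0" using False by simp
  have "2 * [:[:b2:]:] * dy u = 0"
    using arg_cong[OF z1, of dy] 
    by (simp add: pderiv_diff pderiv_mult pderiv_smult numeral_poly)
  then have b2: "b2 = 0" using False by simp
  then have \<rho>: "\<rho> = 0" using z1 by simp
  have "v = [:[:- b1:]:] * u + [:[:r0:]:]" using v b2 \<rho> smult_minus_left[of "[:b1:]" u] by (simp add: pderiv_pCons)
  moreover have "dx u = - [:[:- b1:]:] * dy u"
    unfolding u by (simp add: dx_pcompose pderiv_pcompose dx_pCons pderiv_pCons b2)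
  ultimately show ?thesis using False by blast
qed

text \<open>Coefficients of z are compared. Independence excludes degree 0 and degree at least 2 of
  V in z, the leading coefficient is constant, and what remains is \<open>level_curves\<close> for
  \<open>u\<close>, \<open>v 0\<close> and a multiple of \<open>h\<close>.\<close>

lemma form_A_of_nilp_equations:
  fixes U V W :: "'a::{alg_closed_field, field_char_0} poly3"
  assumes nil: "nilp_equations U V W" and Uz: "diff_z U = 0" and Wz: "diff_z W = 0"
    and U0: "at0 U = 0" and V0: "at0 V = 0" and W0: "at0 W = 0" and ind: "indep3 U V W"
  shows "form_A (vector [U, V, W])"
proof -
  obtain u where u: "U = [:u:]" using Uz pderiv_iszero unfolding diff_z_def by blast
  obtain h where h: "W = [:h:]" using Wz pderiv_iszero unfolding diff_z_def by blast
  define v where "v = coeff V"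
  define d where "d = degree V"
  have u0: "poly (poly u 0) 0 = 0" using U0 by (simp add: u eval3_def)
  have h0: "poly (poly h 0) 0 = 0" using W0 by (simp add: h eval3_def)
  have v0: "poly (poly (v 0) 0) 0 = 0" using V0 by (simp add: v_def eval3_def poly_0_coeff_0)
  have T: "[:dx u:] + diff_y V = 0"
    and M: "[:dx u:] * diff_y V - [:dy u:] * diff_x V - diff_z V * [:dy h:] = 0"
    and D: "diff_z V * [:dx h * dy u - dy h * dx u:] = 0"
    using nil unfolding nilp_equations_def u h by (simp_all add: mult.commute)
  have T0: "dx u + dy (v 0) = 0"
    using arg_cong[OF T, of "\<lambda>p. coeff p 0"] by (simp add: coeff_diff_y v_def)
  have Tk: "dy (v k) = 0" if "k > 0" for k
    using arg_cong[OF T, of "\<lambda>p. coeff p k"] that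
    by (cases k) (simp_all add: coeff_diff_y v_def)
  have Mk: "dx u * dy (v k) - dy u * dx (v k) - of_nat (Suc k) * v (Suc k) * dy h = 0" for k
    using arg_cong[OF M, of "\<lambda>p. coeff p k"]
    by (simp add: coeff_diff_y coeff_diff_x coeff_diff_z v_def mult_ac del: of_nat_Suc)
  have u_nz: "u \<noteq> 0"
  proof
    assume "u = 0"
    then have "Const3 1 * U + Const3 0 * V + Const3 0 * W = 0" by (simp add: u Const3_def)
    then show False using indep3D[OF ind] by fastforce
  qed
  have u_nc: "\<not> (dx u = 0 \<and> dy u = 0)"
  proof
    assume "dx u = 0 \<and> dy u = 0"
    then obtain c where "u = [:[:c:]:]" using dx_eq_0D by blast
    then show False using u0 u_nz by simp
  qed
  \<comment> \<open>If V is free of z, then (U, V) has nilpotent plane Jacobian, hence V is a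
    multiple of U because both vanish at 0.\<close>
  have d0: "d \<noteq> 0"
  proof
    assume "d = 0"
    then obtain w where w: "V = [:w:]" unfolding d_def by (meson degree_eq_zeroE)
    have "dx u + dy w = 0" "dx u * dy w = dy u * dx w"
      using T0 Mk[of 0] by (auto simp: w v_def)
    from nilp_imp_dependent[OF this] obtain b c where bc: "w = [:[:b:]:] * u + [:[:c:]:]"
      using u_nc by auto
    then have "c = 0" using v0 u0 by (simp add: v_def w)
    then have "Const3 b * U + Const3 (- 1) * V + Const3 0 * W = 0"
      by (simp add: u w bc Const3_def flip: smult_add_left)
    then show False using indep3D[OF ind] by fastforce
  qed
  then have "diff_z V \<noteq> 0" by (simp add: diff_z_def pderiv_eq_0_iff d_def)
  then have jac: "dx u * dy h = dy u * dx h" using D by (simp add: mult.commute)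
  have uy: "dy u \<noteq> 0"
  proof
    assume uy: "dy u = 0"
    then have "dy h = 0" using jac u_nc by simp
    then show False using Mk[of 0] T0 uy u_nc by (auto simp: eq_neg_iff_add_eq_0[symmetric])
  qed
  have vd: "v d \<noteq> 0" "v (Suc d) = 0" using d0 by (auto simp: v_def d_def coeff_eq_0)
  \<comment> \<open>In degree d the factor of \<open>dy h\<close> is a multiple of
    \<open>v (Suc d)\<close>, which is 0.\<close>
  have "dy u * dx (v d) = 0" using Mk[of d] Tk[of d] d0 vd by simp
  then have "dx (v d) = 0" "dy (v d) = 0" using uy Tk[of d] d0 by auto
  then obtain e where e: "v d = [:[:e:]:]" using dx_eq_0D by blast
  have e0: "e \<noteq> 0" using vd e by auto
  \<comment> \<open>For d > 1 the coefficient of z^(d-1) says that E h + p u is free of y. Mixed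
    derivatives then make \<open>p\<close> and this sum constant, which is a linear relation between
    U and W.\<close>
  have d1: "d = 1"
  proof (rule ccontr)
    assume "d \<noteq> 1"
    then obtain k where k: "d = Suc k" "k > 0" using d0 by (cases d) auto
    define E where "E = [:[:of_nat d * e:]:]"
    define p where "p = dx (v k)"
    have py: "dy p = 0" using Tk[OF k(2)] by (simp add: p_def flip: dx_dy)
    have "of_nat (Suc k) * v (Suc k) = E"
      using e k by (simp add: E_def of_nat_poly mult.commute del: of_nat_Suc)
    then have "dx u * dy (v k) - dy u * dx (v k) - E * dy h = 0"
      using Mk[of k] by (simp only:)
    then have rel: "p * dy u + E * dy h = 0"
      using Tk[OF k(2)] unfolding p_def by algebra
    define w where "w = E * h + p * u"
    have E': "dx E = 0" "dy E = 0" by (auto simp: E_def dx_pCons)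
    have wy: "dy w = 0" using rel by (simp add: w_def pderiv_add pderiv_mult E' py algebra_simps)
    have "dx w = E * dx h + dx p * u + p * dx u"
      by (simp add: w_def dx_add dx_mult E')
    then have "dy u * (dx w - u * dx p) = 0" using rel jac by algebra
    then have wx: "dx w = u * dx p" using uy by simp
    have "dy (u * dx p) = 0" using wy by (simp flip: wx dx_dy)
    then have "dx p = 0" using uy py by (simp add: pderiv_mult flip: dx_dy)
    then obtain \<pi> where \<pi>: "p = [:[:\<pi>:]:]" using py dx_eq_0D by blast
    have "dx w = 0" using wx \<open>dx p = 0\<close> by simp
    then obtain c where c: "w = [:[:c:]:]" using wy dx_eq_0D by blast
    have "poly (poly w 0) 0 = 0" by (simp add: w_def u0 h0)
    then have "w = 0" using c by simp
    then have "Const3 \<pi> * U + Const3 0 * V + Const3 (of_nat d * e) * W = 0"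
      by (simp add: u h Const3_def w_def E_def \<pi> add.commute)
    then have "of_nat d * e = 0" using indep3D[OF ind] by blast
    then show False using e0 d0 by simp
  qed
  have V: "V = [:v 0, [:[:e:]:]:]"
  proof (rule poly_eqI)
    fix n
    show "coeff V n = coeff [:v 0, [:[:e:]:]:] n"
      using e d1 by (auto simp: v_def d_def coeff_pCons coeff_eq_0 split: nat.split)
  qed
  have qy: "dy (v 0) = - dx u" using T0 by (simp add: eq_neg_iff_add_eq_0 add.commute)
  \<comment> \<open>Multiplying the third component by \<open>e\<close> normalises the z-coefficient
    of V to 1.\<close>
  interpret level_curves u "v 0" "[:[:e:]:] * h"
  proof
    show "dx u * dy ([:[:e:]:] * h) = dy u * dx ([:[:e:]:] * h)"
      unfolding pderiv_mult dx_mult using jac by (simp add: dx_pCons)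
    show "(dx u)\<^sup>2 + dy u * dx (v 0) + dy ([:[:e:]:] * h) = 0"
    proof -
      have "dy ([:[:e:]:] * h) = [:[:e:]:] * dy h" by (simp add: pderiv_smult)
      moreover have "dx u * dy (v 0) - dy u * dx (v 0) - [:[:e:]:] * dy h = 0"
        using Mk[of 0] e d1 by simp
      ultimately show ?thesis using qy by algebra
    qed
  qed (rule qy)
  obtain g b1 b2 \<rho> r0 c where ug: "u = pcompose (const_y g) [:[:0, b1, b2:], 1:]"
    and q: "v 0 = - ([:pderiv [:0, b1, b2:]:] * u) + [:[:r0, \<rho>:]:]"
    and hu: "[:[:e:]:] * h = [:[:b2:]:] * u\<^sup>2 - [:[:\<rho>:]:] * u + [:[:c:]:]"
    using normal_form[OF uy] .
  have "r0 = 0" using v0 u0 unfolding q by simp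
  have "c = 0" using arg_cong[OF hu, of "\<lambda>p. poly (poly p 0) 0"] u0 h0 by simp
  define b where "b = [:0, b1, b2:]"
  define c0 l2 where "c0 = b2 / e" and "l2 = - \<rho> / e"
  have W: "W = Const3 c0 * U\<^sup>2 + Const3 l2 * U"
  proof -
    define i where "i = [:[:inverse e:]:]"
    have "i * [:[:e:]:] = 1" "i * [:[:b2:]:] = [:[:c0:]:]" "i * [:[:\<rho>:]:] = - [:[:l2:]:]"
      using e0 by (simp_all add: i_def c0_def l2_def field_simps pCons_one)
    then have "h = [:[:c0:]:] * u\<^sup>2 + [:[:l2:]:] * u"
      using hu unfolding \<open>c = 0\<close> by (simp only: pCons_0_0) algebra
    then show ?thesis by (simp add: h u Const3_def power2_eq_square)
  qed
  have "b2 \<noteq> 0"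
  proof
    assume "b2 = 0"
    then have "Const3 l2 * U + Const3 0 * V + Const3 (- 1) * W = 0"
      unfolding W c0_def by (simp add: Const3_def flip: smult_add_left)
    then show False using indep3D[OF ind] by fastforce
  qed
  \<comment> \<open>The witnesses for the form are a = 1 and a \<open>b\<close> without constant
    term.\<close>
  have lin: "Const3 1 * varY + subst1 b varX = [:[:b, 1:]:]"
    by (simp add: subst1_varX Const3_def varY_def)
  have U: "U = subst1 g (Const3 1 * varY + subst1 b varX)"
    unfolding lin subst1_const_z by (simp add: u ug b_def)
  have V': "V = Const3 e * varZ - Const3 (inverse 1) * subst1 (pderiv b) varX * U
      - Const3 (e * l2) * varX"
  proof -
    have "Const3 (inverse 1) = (1 :: 'a poly3)" by (simp add: Const3_def pCons_one)
    then show ?thesis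
      unfolding V q \<open>r0 = 0\<close> subst1_varX using e0
      by (simp add: Const3_def varZ_def varX_def u b_def l2_def)
  qed
  have g0: "poly g 0 = 0"
  proof -
    have "poly (poly (pcompose (const_y g) w) 0) 0 = poly g (poly (poly w 0) 0)" for w
    proof (induction g)
      case (pCons a g)
      have "const_y (pCons a g) = pCons [:a:] (const_y g)"
        by (simp add: const_y_def map_poly_pCons)
      with pCons show ?case by (simp add: pcompose_pCons)
    qed (simp add: const_y_def)
    then show ?thesis using u0 by (simp add: ug)
  qed
  have "degree g \<noteq> 0"
  proof
    assume "degree g = 0"
    then obtain a where "g = [:a:]" by (meson degree_eq_zeroE)
    then show False using uy ug by (simp add: const_y_def map_poly_pCons)
  qed
  then have "degree g \<ge> 1" by simp
  moreover have "c0 \<noteq> 0" using \<open>b2 \<noteq> 0\<close> e0 by (simp add: c0_def)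
  moreover have "b = [:0, b1, e * c0 * 1:]" using e0 by (simp add: b_def c0_def)
  moreover have "V = Const3 e * varZ - Const3 (inverse 1) * subst1 (pderiv b) varX
      * subst1 g (Const3 1 * varY + subst1 b varX) - Const3 (e * l2) * varX"
    using V' by (simp only: U[symmetric])
  ultimately show ?thesis unfolding form_A_def vector_3
    using e0 g0 U W one_neq_zero by metis
qed

section \<open>Linear changes of coordinates\<close>

text \<open>Stated for a general coefficient homomorphism so that it can be iterated through the
  three layers: from \<open>Const3\<close> to \<open>subst1\<close>, then to \<open>subst2\<close>
  and \<open>subst3\<close>.\<close>

lemma eval_map_poly_hom:
  fixes \<phi> :: "'r::comm_ring_1 \<Rightarrow> 's::comm_ring_1"
  assumes add: "\<And>a b. \<phi> (a + b) = \<phi> a + \<phi> b" and mult: "\<And>a b. \<phi> (a * b) = \<phi> a * \<phi> b"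
  shows "poly (map_poly \<phi> (p + q)) t = poly (map_poly \<phi> p) t + poly (map_poly \<phi> q) t"
    and "poly (map_poly \<phi> (p * q)) t = poly (map_poly \<phi> p) t * poly (map_poly \<phi> q) t"
    and "poly (map_poly \<phi> (pCons a p)) t = \<phi> a + t * poly (map_poly \<phi> p) t"
proof -
  have zero: "\<phi> 0 = 0" using add[of 0 0] by simp
  have add': "poly (map_poly \<phi> (p + q)) t = poly (map_poly \<phi> p) t + poly (map_poly \<phi> q) t" for p q
  proof -
    have "map_poly \<phi> (p + q) = map_poly \<phi> p + map_poly \<phi> q"
      by (rule poly_eqI) (simp add: coeff_map_poly zero add)
    then show ?thesis by simp
  qed
  have pc: "poly (map_poly \<phi> (pCons a p)) t = \<phi> a + t * poly (map_poly \<phi> p) t" for a p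
    by (simp add: map_poly_pCons zero)
  have sm: "poly (map_poly \<phi> (smult a p)) t = \<phi> a * poly (map_poly \<phi> p) t" for a p
    by (induction p) (simp_all add: pc mult algebra_simps)
  show "poly (map_poly \<phi> (p + q)) t = poly (map_poly \<phi> p) t + poly (map_poly \<phi> q) t" by (rule add')
  show "poly (map_poly \<phi> (p * q)) t = poly (map_poly \<phi> p) t * poly (map_poly \<phi> q) t"
    by (induction p) (simp_all add: pc sm add' zero algebra_simps)
  show "poly (map_poly \<phi> (pCons a p)) t = \<phi> a + t * poly (map_poly \<phi> p) t" by (rule pc)
qed

lemma Const3_add: "Const3 (a + b) = Const3 a + Const3 b"
  and Const3_mult: "Const3 (a * b) = Const3 a * Const3 b"
  and Const3_diff: "Const3 (a - b) = Const3 a - Const3 b"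
  and Const3_minus: "Const3 (- a) = - Const3 a"
  and Const3_0 [simp]: "Const3 0 = 0"
  and Const3_1 [simp]: "Const3 1 = 1"
  by (simp_all add: Const3_def pCons_one)

lemma subst1_add: "subst1 (p + q) t = subst1 p t + subst1 q t"
  and subst1_mult: "subst1 (p * q) t = subst1 p t * subst1 q t"
  unfolding subst1_def by (rule eval_map_poly_hom; simp add: Const3_add Const3_mult)+

definition subst2 :: "'a::comm_ring_1 poly poly \<Rightarrow> 'a poly3 \<Rightarrow> 'a poly3 \<Rightarrow> 'a poly3" where
  "subst2 q a b = poly (map_poly (\<lambda>r. subst1 r a) q) b"

lemma subst2_add: "subst2 (p + q) a b = subst2 p a b + subst2 q a b"
  and subst2_mult: "subst2 (p * q) a b = subst2 p a b * subst2 q a b"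
  and subst2_pCons: "subst2 (pCons r q) a b = subst1 r a + b * subst2 q a b"
  unfolding subst2_def by (rule eval_map_poly_hom; simp add: subst1_add subst1_mult)+

lemma subst3_add: "subst3 (p + q) a b c = subst3 p a b c + subst3 q a b c"
  and subst3_mult: "subst3 (p * q) a b c = subst3 p a b c * subst3 q a b c"
  and subst3_pCons: "subst3 (pCons r q) a b c = subst2 r a b + c * subst3 q a b c"
  unfolding subst3_def subst2_def[symmetric]
  by (rule eval_map_poly_hom; simp add: subst2_add subst2_mult)+

lemma subst2_0 [simp]: "subst2 0 a b = 0"
  by (simp add: subst2_def)

lemma subst3_0 [simp]: "subst3 0 a b c = 0"
  by (simp add: subst3_def)

lemma subst1_1 [simp]: "subst1 1 t = 1"
  by (simp add: subst1_def)

lemma subst2_1 [simp]: "subst2 1 a b = 1"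
  by (simp add: subst2_def)

lemma subst3_Const3 [simp]: "subst3 (Const3 k) a b c = Const3 k"
  by (simp add: Const3_def[of k] subst3_pCons subst2_pCons subst1_pCons)

lemma subst3_1 [simp]: "subst3 1 a b c = 1"
  using subst3_Const3[of 1 a b c] by simp

lemma subst3_varX [simp]: "subst3 varX a b c = a"
  by (simp add: varX_def subst3_pCons subst2_pCons subst1_pCons)

lemma subst3_varY [simp]: "subst3 varY a b c = b"
  by (simp add: varY_def subst3_pCons subst2_pCons)

lemma subst3_varZ [simp]: "subst3 varZ a b c = c"
  using subst3_1[of a b c] by (simp add: varZ_def subst3_pCons)

lemma subst3_minus: "subst3 (- p) a b c = - subst3 p a b c"
  using subst3_add[of p "- p" a b c] by (simp add: eq_neg_iff_add_eq_0 add.commute)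

lemma subst3_diff: "subst3 (p - q) a b c = subst3 p a b c - subst3 q a b c"
  using subst3_add[of p "- q" a b c] by (simp add: subst3_minus)

text \<open>K[x,y,z] is generated by constants and variables, so identities between ring
  homomorphisms or derivations need checking only there.\<close>

lemma poly3_induct [case_names Const3 varX varY varZ add mult]:
  assumes const: "\<And>k. P (Const3 k)" and x: "P varX" and y: "P varY" and z: "P varZ"
    and add: "\<And>p q. P p \<Longrightarrow> P q \<Longrightarrow> P (p + q)" and mult: "\<And>p q. P p \<Longrightarrow> P q \<Longrightarrow> P (p * q)"
  shows "P (p :: 'a::comm_ring_1 poly3)"
proof -
  have zero: "P 0" using const[of 0] by simp
  have X: "P [:[:r:]:]" for r
  proof (induction r)
    case (pCons c r)
    have "[:[:pCons c r:]:] = Const3 c + varX * [:[:r:]:]" by (simp add: Const3_def varX_def)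
    then show ?case using pCons const x add mult by metis
  qed (simp add: zero)
  have Y: "P [:q:]" for q
  proof (induction q)
    case (pCons r q)
    have "[:pCons r q:] = [:[:r:]:] + varY * [:q:]" by (simp add: varY_def)
    then show ?case using pCons X y add mult by metis
  qed (simp add: zero)
  show ?thesis
  proof (induction p)
    case (pCons q p)
    have "pCons q p = [:q:] + varZ * p" by (simp add: varZ_def)
    then show ?case using pCons Y z add mult by metis
  qed (simp add: zero)
qed

lemma subst3_inverse:
  assumes "subst3 a a' b' c' = varX" "subst3 b a' b' c' = varY" "subst3 c a' b' c' = varZ"
  shows "subst3 (subst3 p a b c) a' b' c' = p"
  by (induction p rule: poly3_induct) (simp_all add: assms subst3_add subst3_mult)

lemma subst3_subst1: "subst3 (subst1 g t) a b c = subst1 g (subst3 t a b c)"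
  by (induction g) (simp_all add: subst1_pCons subst3_add subst3_mult)

lemma at0_subst3:
  assumes "at0 a = 0" "at0 b = 0" "at0 c = 0"
  shows "at0 (subst3 p a b c) = at0 p"
proof (induction p rule: poly3_induct)
  case (add p q)
  then show ?case by (simp add: subst3_add) (simp add: eval3_def)
next
  case (mult p q)
  then show ?case by (simp add: subst3_mult) (simp add: eval3_def)
qed (simp_all add: assms, simp_all add: eval3_def varX_def varY_def varZ_def)

section \<open>Partial derivatives in three variables and the chain rule\<close>

lemma diff_x_add: "diff_x (p + q) = diff_x p + diff_x q"
  and diff_y_add: "diff_y (p + q) = diff_y p + diff_y q"
  and diff_z_add: "diff_z (p + q) = diff_z p + diff_z q"
  by (auto intro!: poly_eqI simp: coeff_diff_x coeff_diff_y dx_add pderiv_add diff_z_def)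

lemma diff_x_mult: "diff_x (p * q) = p * diff_x q + diff_x p * q"
  unfolding diff_x_def dx_def[symmetric]
  by (rule map_poly_leibniz) (simp_all add: dx_add dx_mult)

lemma diff_y_mult: "diff_y (p * q) = p * diff_y q + diff_y p * q"
  unfolding diff_y_def
  by (rule map_poly_leibniz) (simp_all add: pderiv_add pderiv_mult mult.commute)

lemma diff_z_mult: "diff_z (p * q) = p * diff_z q + diff_z p * q"
  by (simp add: diff_z_def pderiv_mult mult.commute)

lemma diff_gen [simp]:
  "diff_x (Const3 k) = 0" "diff_y (Const3 k) = 0" "diff_z (Const3 k) = 0"
  "diff_x varX = 1" "diff_y varX = 0" "diff_z varX = 0"
  "diff_x varY = 0" "diff_y varY = 1" "diff_z varY = 0"
  "diff_x varZ = 0" "diff_y varZ = 0" "diff_z varZ = 1"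
  by (simp_all add: Const3_def varX_def varY_def dx_pCons pderiv_pCons)
    (simp_all add: pCons_one varZ_def diff_x_def diff_y_def diff_z_def map_poly_pCons map_poly_1 pderiv_pCons)

lemma diff_Const3_mult:
  "diff_x (Const3 k * p) = Const3 k * diff_x p"
  "diff_y (Const3 k * p) = Const3 k * diff_y p"
  "diff_z (Const3 k * p) = Const3 k * diff_z p"
  by (simp_all add: diff_x_mult diff_y_mult diff_z_mult)

lemma diff_diff:
  "diff_x (p - q) = diff_x p - diff_x q"
  "diff_y (p - q) = diff_y p - diff_y q"
  "diff_z (p - q) = diff_z p - diff_z q"
  by (auto intro!: poly_eqI simp: coeff_diff_x coeff_diff_y dx_diff pderiv_diff diff_z_def)

text \<open>Both sides obey the same sum and product rules in \<open>p\<close>, so generators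
  suffice. An abstract derivation covers all three partial derivatives at once.\<close>

lemma chain_rule:
  fixes \<delta> :: "'a::idom poly3 \<Rightarrow> 'a poly3"
  assumes add: "\<And>p q. \<delta> (p + q) = \<delta> p + \<delta> q" and mult: "\<And>p q. \<delta> (p * q) = p * \<delta> q + \<delta> p * q"
    and const: "\<And>k. \<delta> (Const3 k) = 0"
  shows "\<delta> (subst3 p a b c) = subst3 (diff_x p) a b c * \<delta> a + subst3 (diff_y p) a b c * \<delta> b
    + subst3 (diff_z p) a b c * \<delta> c"
  by (induction p rule: poly3_induct)
    (simp_all add: const add mult subst3_add subst3_mult diff_x_add diff_y_add diff_z_add
      diff_x_mult diff_y_mult diff_z_mult algebra_simps)

lemmas diff_x_subst3 = chain_rule[of diff_x, OF diff_x_add diff_x_mult diff_gen(1)]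
lemmas diff_y_subst3 = chain_rule[of diff_y, OF diff_y_add diff_y_mult diff_gen(2)]
lemmas diff_z_subst3 = chain_rule[of diff_z, OF diff_z_add diff_z_mult diff_gen(3)]

section \<open>Exchange of x and y\<close>

definition swap :: "'a::comm_ring_1 poly3 \<Rightarrow> 'a poly3" where
  "swap p = subst3 p varY varX varZ"

lemma swap_hom:
  "swap (p + q) = swap p + swap q" "swap (p - q) = swap p - swap q" "swap (p * q) = swap p * swap q"
  "swap (Const3 k) = Const3 k" "swap 0 = 0"
  by (simp_all add: swap_def subst3_add subst3_diff subst3_mult)

lemma swap_swap [simp]: "swap (swap p) = p"
  unfolding swap_def by (rule subst3_inverse) simp_all

lemma diff_swap:
  "diff_x (swap p) = swap (diff_y p)" "diff_y (swap p) = swap (diff_x p)" "diff_z (swap p) = swap (diff_z p)"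
  by (simp_all add: swap_def diff_x_subst3 diff_y_subst3 diff_z_subst3)

lemma at0_var: "at0 varX = 0" "at0 varY = 0" "at0 varZ = 0"
  by (simp_all add: eval3_def varX_def varY_def varZ_def)

lemma at0_swap: "at0 (swap p) = at0 p"
  unfolding swap_def by (rule at0_subst3) (simp_all add: at0_var)

text \<open>Exchanging x and y together with the first two components is a linear conjugation, so
  the invariants of the Jacobian go over into their images under \<open>swap\<close>.\<close>

lemma nilp_equations_swap:
  assumes "nilp_equations U V W"
  shows "nilp_equations (swap V) (swap U) (swap W)"
proof -
  have e: "diff_x U + diff_y V = 0"
     "diff_x U * diff_y V - diff_y U * diff_x V - diff_z U * diff_x W - diff_z V * diff_y W = 0"
     "diff_z V * (diff_x W * diff_y U - diff_y W * diff_x U)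
       = diff_z U * (diff_x W * diff_y V - diff_y W * diff_x V)"
    using assms by (auto simp: nilp_equations_def)
  from e[THEN arg_cong[of _ _ swap]] show ?thesis
    unfolding nilp_equations_def diff_swap swap_hom by (intro conjI) algebra+
qed

lemma indep3_swap:
  assumes "indep3 U V W"
  shows "indep3 (swap V) (swap U) (swap W)"
  unfolding indep3_def
proof (intro allI impI)
  fix a b c
  assume "Const3 a * swap V + Const3 b * swap U + Const3 c * swap W = 0"
  then have "swap (Const3 a * swap V + Const3 b * swap U + Const3 c * swap W) = swap 0" by simp
  then have "Const3 b * U + Const3 a * V + Const3 c * W = 0"
    by (simp add: swap_hom add.commute)
  then show "a = 0 \<and> b = 0 \<and> c = 0" using indep3D[OF assms] by blast
qed

lemma form_B_of_swap:
  assumes "form_A (vector [swap V, swap U, swap W])"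
  shows "form_B (vector [U, V, W])"
proof -
  have s1: "swap (subst1 p t) = subst1 p (swap t)" for p t
    by (simp add: swap_def subst3_subst1)
  have sv: "swap varX = varY" "swap varY = varX" "swap varZ = varZ" by (simp_all add: swap_def)
  obtain v1 c0 a l1 l2 l2' g b where *: "v1 \<noteq> 0" "c0 \<noteq> 0" "a \<noteq> 0" "poly g 0 = 0" "degree g \<ge> 1"
      "b = [:l2', l1, v1 * c0 * a:]"
      "swap V = subst1 g (Const3 a * varY + subst1 b varX)"
      "swap U = Const3 v1 * varZ
                - Const3 (inverse a) * subst1 (pderiv b) varX * swap V
                - Const3 (v1 * l2) * varX"
      "swap W = Const3 c0 * (swap V * swap V) + Const3 l2 * swap V"
    using assms unfolding form_A_def vector_3 power2_eq_square by metis
  have "swap (swap V) = subst1 g (Const3 a * varX + subst1 b varY)"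
    unfolding *(7) by (simp add: swap_hom s1 sv)
  moreover have "swap (swap U) = Const3 v1 * varZ
                - Const3 (inverse a) * subst1 (pderiv b) varY * V
                - Const3 (v1 * l2) * varY"
    unfolding *(8) by (simp add: swap_hom s1 sv)
  moreover have "swap (swap W) = Const3 c0 * V\<^sup>2 + Const3 l2 * V"
    unfolding *(9) by (simp add: swap_hom power2_eq_square)
  ultimately show ?thesis using *(1-6) unfolding form_B_def vector_3 swap_swap by metis
qed

section \<open>The shear x -> x + l y\<close>

definition shear :: "'a::comm_ring_1 \<Rightarrow> 'a poly3 \<Rightarrow> 'a poly3" where
  "shear l p = subst3 p (varX + Const3 l * varY) varY varZ"

lemma shear_hom:
  "shear l (p + q) = shear l p + shear l q" "shear l (p - q) = shear l p - shear l q"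
  "shear l (p * q) = shear l p * shear l q" "shear l (Const3 k) = Const3 k" "shear l 0 = 0"
  by (simp_all add: shear_def subst3_add subst3_diff subst3_mult)

lemma shear_inverse: "shear (- l) (shear l p) = p"
  unfolding shear_def
  by (rule subst3_inverse) (simp_all add: subst3_add subst3_mult Const3_minus)

lemma diff_shear:
  "diff_x (shear l p) = shear l (diff_x p)"
  "diff_y (shear l p) = Const3 l * shear l (diff_x p) + shear l (diff_y p)"
  "diff_z (shear l p) = shear l (diff_z p)"
  by (simp_all add: shear_def diff_x_subst3 diff_y_subst3 diff_z_subst3 diff_x_add diff_y_add
      diff_z_add diff_Const3_mult)

lemma at0_shear: "at0 (shear l p) = at0 p"
  unfolding shear_def
  by (rule at0_subst3) (simp_all add: at0_var, simp add: eval3_def varX_def varY_def)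

text \<open>The new triple is the conjugate by the shear; its Jacobian is similar to the sheared old
  one and has the same invariants.\<close>

lemma nilp_equations_shear:
  assumes "nilp_equations U V W"
  shows "nilp_equations (shear l (U - Const3 l * V)) (shear l V) (shear l W)"
proof -
  have e: "diff_x U + diff_y V = 0"
     "diff_x U * diff_y V - diff_y U * diff_x V - diff_z U * diff_x W - diff_z V * diff_y W = 0"
     "diff_z V * (diff_x W * diff_y U - diff_y W * diff_x U)
       = diff_z U * (diff_x W * diff_y V - diff_y W * diff_x V)"
    using assms by (auto simp: nilp_equations_def)
  from e[THEN arg_cong[of _ _ "shear l"]] show ?thesis
    unfolding nilp_equations_def diff_shear diff_diff diff_Const3_mult shear_hom
    by (intro conjI) algebra+
qed

lemma indep3_shear:
  assumes "indep3 U V W"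
  shows "indep3 (shear l (U - Const3 l * V)) (shear l V) (shear l W)"
  unfolding indep3_def
proof (intro allI impI)
  fix a b c
  assume "Const3 a * shear l (U - Const3 l * V) + Const3 b * shear l V + Const3 c * shear l W = 0"
  then have "shear l (Const3 a * (U - Const3 l * V) + Const3 b * V + Const3 c * W) = 0"
    by (simp add: shear_hom)
  then have "Const3 a * (U - Const3 l * V) + Const3 b * V + Const3 c * W = 0"
    by (metis shear_inverse shear_hom(5))
  then have "Const3 a * U + Const3 (b - a * l) * V + Const3 c * W = 0"
    by (simp add: Const3_diff Const3_mult algebra_simps)
  from indep3D[OF assms this] show "a = 0 \<and> b = 0 \<and> c = 0" by auto
qed

definition shear_matrix :: "'a::field \<Rightarrow> 'a^3^3" where
  "shear_matrix l = vector [vector [1, l, 0], vector [0, 1, 0], vector [0, 0, 1]]"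

lemma shear_matrix_mult: "shear_matrix l ** shear_matrix m = shear_matrix (l + m)"
  by (simp add: shear_matrix_def vec_eq_iff forall_3 matrix_matrix_mult_def sum_3 add.commute)

lemma shear_matrix_0: "shear_matrix 0 = mat 1"
  by (simp add: shear_matrix_def vec_eq_iff forall_3 mat_def)

lemma shear_matrix_inverse:
  "shear_matrix l ** shear_matrix (- l) = mat 1" "shear_matrix (- l) ** shear_matrix l = mat 1"
  by (simp_all add: shear_matrix_mult shear_matrix_0)

lemma invertible_shear_matrix: "invertible (shear_matrix l)"
  unfolding invertible_def using shear_matrix_inverse by blast

lemma matrix_inv_shear_matrix: "matrix_inv (shear_matrix l) = shear_matrix (- l)"
proof -
  have "shear_matrix l ** matrix_inv (shear_matrix l) = mat 1"
    unfolding matrix_inv_def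
    by (rule someI2[of _ "shear_matrix (- l)"]) (auto simp: shear_matrix_inverse)
  then have "shear_matrix (- l) ** (shear_matrix l ** matrix_inv (shear_matrix l)) = shear_matrix (- l)"
    by simp
  then show ?thesis by (simp add: matrix_mul_assoc shear_matrix_inverse)
qed

text \<open>The inverse shear subtracts l times the second component from the first, which is what
  later removes z there.\<close>

lemma conj3_shear_matrix:
  "conj3 (shear_matrix l) (vector [U, V, W])
    = vector [shear l (U - Const3 l * V), shear l V, shear l W]"
proof -
  have lin: "linear_map3 (shear_matrix m) = vector [varX + Const3 m * varY, varY, varZ]" for m :: 'a
    by (simp add: linear_map3_def shear_matrix_def vec_eq_iff forall_3)
  show ?thesis
    unfolding conj3_def matrix_inv_shear_matrix lin
    by (simp add: comp3_def vec_eq_iff forall_3 shear_def subst3_add subst3_mult subst3_diff Const3_minus)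
qed

section \<open>Nilpotent matrices of size three\<close>

text \<open>The characteristic equation is applied to an arbitrary \<open>X\<close> so that every
  power of \<open>A\<close> can be inserted; the coefficients are trace, sum of principal minors and
  determinant.\<close>

lemma cayley_hamilton_3:
  fixes a b c d e f g h i :: "'a::idom" and X :: "'a^'n^3"
  assumes A: "A = vector [vector [a, b, c], vector [d, e, f], vector [g, h, i]]"
  shows "vec_nth (vec_nth (A ** (A ** (A ** X))) k) j
    = (a + e + i) * vec_nth (vec_nth (A ** (A ** X)) k) j
      - (a * e - b * d + a * i - c * g + e * i - f * h) * vec_nth (vec_nth (A ** X) k) j
      + (a * (e * i - f * h) - b * (d * i - f * g) + c * (d * h - e * g)) * vec_nth (vec_nth X k) j"
proof -
  have "\<forall>k. vec_nth (vec_nth (A ** (A ** (A ** X))) k) j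
    = (a + e + i) * vec_nth (vec_nth (A ** (A ** X)) k) j
      - (a * e - b * d + a * i - c * g + e * i - f * h) * vec_nth (vec_nth (A ** X) k) j
      + (a * (e * i - f * h) - b * (d * i - f * g) + c * (d * h - e * g)) * vec_nth (vec_nth X k) j"
    unfolding forall_3 matrix_matrix_mult_def sum_3 vec_lambda_beta A vector_3
    by (intro conjI) algebra+
  then show ?thesis by blast
qed

text \<open>Let \<open>P k\<close> be the last nonzero power. Cayley-Hamilton applied to
  \<open>P k\<close>, P(k-1) and P(k-2) yields in turn D = 0, M = 0 and t = 0, cancelling a nonzero
  entry of \<open>P k\<close>.\<close>

lemma nilpotent_3_invariants:
  fixes a b c d e f g h i :: "'a::idom"
  assumes "nilpotent_matrix (vector [vector [a, b, c], vector [d, e, f], vector [g, h, i]] :: 'a^3^3)"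
  shows "a + e + i = 0"
    and "a * e - b * d + a * i - c * g + e * i - f * h = 0"
    and "a * (e * i - f * h) - b * (d * i - f * g) + c * (d * h - e * g) = 0"
proof -
  define A :: "'a^3^3" where "A = vector [vector [a, b, c], vector [d, e, f], vector [g, h, i]]"
  define P where "P k = (((**) A) ^^ k) (mat 1)" for k
  define t where "t = a + e + i"
  define M where "M = a * e - b * d + a * i - c * g + e * i - f * h"
  define D where "D = a * (e * i - f * h) - b * (d * i - f * g) + c * (d * h - e * g)"
  have CH: "vec_nth (vec_nth (A ** (A ** (A ** X))) k) j = t * vec_nth (vec_nth (A ** (A ** X)) k) j
      - M * vec_nth (vec_nth (A ** X) k) j + D * vec_nth (vec_nth X k) j" for X k j
    unfolding t_def M_def D_def by (rule cayley_hamilton_3[OF A_def])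
  have P_Suc: "P (Suc k) = A ** P k" for k by (simp add: P_def)
  have A0: "A ** 0 = 0" by (simp add: matrix_matrix_mult_def vec_eq_iff)
  obtain m0 where "P m0 = 0" using assms unfolding nilpotent_matrix_def P_def A_def by blast
  define m where "m = (LEAST m. P m = 0)"
  have Pm: "P m = 0" unfolding m_def by (rule LeastI) fact
  have nz: "P k \<noteq> 0" if "k < m" for k using that not_less_Least unfolding m_def by blast
  have "vec_nth (vec_nth (P 0) 1) 1 = 1" by (simp add: P_def mat_def)
  then have "P 0 \<noteq> 0" by force
  then obtain k where k: "m = Suc k" using Pm by (cases m) auto
  have Ak: "A ** P k = 0" using Pm k P_Suc by simp
  obtain r s where rs: "vec_nth (vec_nth (P k) r) s \<noteq> 0" using nz[of k] k by (auto simp: vec_eq_iff)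
  have D: "D = 0" using CH[of "P k" r s] rs by (simp add: Ak A0)
  \<comment> \<open>For k < 2 there are not two earlier powers: k = 0 means A = 0, and for k = 1 the
    trace of A^2 = 0 equals t^2 - 2 M.\<close>
  consider "k = 0" | "k = 1" | n where "k = Suc (Suc n)"
    by (metis One_nat_def not0_implies_Suc)
  then have "t = 0 \<and> M = 0"
  proof cases
    case 1
    then have "A = 0" using Ak by (simp add: P_def)
    then have "a = 0 \<and> b = 0 \<and> c = 0 \<and> d = 0 \<and> e = 0 \<and> f = 0 \<and> g = 0 \<and> h = 0 \<and> i = 0"
      by (simp add: A_def vec_eq_iff forall_3)
    then show ?thesis by (simp add: t_def M_def)
  next
    case 2
    then have AA: "A ** A = 0" using Ak by (simp add: P_def)
    have "P k = A" using 2 by (simp add: P_def)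
    then have M: "M = 0" using CH[of "mat 1" r s] D rs by (simp add: AA A0)
    have "vec_nth (vec_nth (A ** A) 1) 1 + vec_nth (vec_nth (A ** A) 2) 2
        + vec_nth (vec_nth (A ** A) 3) 3 = t * t - 2 * M"
      unfolding matrix_matrix_mult_def sum_3 vec_lambda_beta A_def vector_3 t_def M_def
      by algebra
    then have "t * t = 0" using M AA by simp
    with M show ?thesis by simp
  next
    case (3 n)
    have eqs: "A ** P (Suc n) = P k" "A ** (A ** P n) = P k" using 3 by (simp_all add: P_Suc)
    have M: "M = 0" using CH[of "P (Suc n)" r s] D rs by (simp add: eqs Ak A0)
    have "t = 0" using CH[of "P n" r s] D M rs by (simp add: eqs Ak A0)
    with M show ?thesis by simp
  qed
  then show "a + e + i = 0" and "a * e - b * d + a * i - c * g + e * i - f * h = 0"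
    unfolding t_def M_def by auto
  show "a * (e * i - f * h) - b * (d * i - f * g) + c * (d * h - e * g) = 0"
    using D unfolding D_def .
qed

lemma nilp_equations_of_nilpotent:
  assumes "nilpotent_matrix (poly_jacobian (vector [U, V, W]))" and "diff_z W = 0"
  shows "nilp_equations U V W"
proof -
  have J: "poly_jacobian (vector [U, V, W]) = vector
      [vector [diff_x U, diff_y U, diff_z U], vector [diff_x V, diff_y V, diff_z V],
       vector [diff_x W, diff_y W, 0]]"
    by (simp add: poly_jacobian_def vec_eq_iff forall_3 assms(2))
  show ?thesis
    unfolding nilp_equations_def using nilpotent_3_invariants[OF assms(1)[unfolded J]]
    by (intro conjI) algebra+
qed

lemma deg_z_eq_degree: "deg_z p = degree p"
proof -
  have eq: "{k. \<exists>i j. coeff3 p i j k \<noteq> 0} = {k. coeff p k \<noteq> 0}"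
    by (auto simp: coeff3_def poly_eq_iff)
  show ?thesis unfolding deg_z_def eq
  proof (rule Max_eqI)
    show "finite (insert 0 {k. coeff p k \<noteq> 0})"
      by (rule finite_subset[of _ "{..degree p}"]) (auto simp: le_degree)
    show "degree p \<in> insert 0 {k. coeff p k \<noteq> 0}"
      by (cases "p = 0") auto
  qed (auto simp: le_degree)
qed

lemma diff_z_eq_0_iff: "diff_z p = 0 \<longleftrightarrow> deg_z p = 0" for p :: "'a::field_char_0 poly3"
  by (simp add: diff_z_def pderiv_eq_0_iff deg_z_eq_degree)

lemma indep3_of_lin_indep3:
  assumes "lin_indep3 (vector [U, V, W])"
  shows "indep3 U V W"
  unfolding indep3_def
proof (intro allI impI)
  fix a b c
  assume "Const3 a * U + Const3 b * V + Const3 c * W = 0"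
  then have "(vector [a, b, c] :: 'a^3) = 0"
    using assms unfolding lin_indep3_def by (simp add: sum_3)
  then show "a = 0 \<and> b = 0 \<and> c = 0" by (metis vector_3 zero_index)
qed

section \<open>Maps with two components depending on \<open>z\<close>\<close>

text \<open>The Jacobian determinant in x and y; it vanishes exactly when the two gradients are
  parallel.\<close>

definition br :: "'a::idom poly poly \<Rightarrow> 'a poly poly \<Rightarrow> 'a poly poly" where
  "br f g = dx f * dy g - dy f * dx g"

lemma br_trans_eq_0:
  assumes "br f g = 0" "br f k = 0" "\<not> (dx f = 0 \<and> dy f = 0)"
  shows "br g k = 0"
proof -
  have "dx f * br g k = 0" "dy f * br g k = 0"
    using assms(1,2) unfolding br_def by algebra+
  then show ?thesis using assms(3) by auto
qed

lemma br_const [simp]: "br f [:[:c:]:] = 0" "br [:[:c:]:] f = 0"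
  by (simp_all add: br_def dx_pCons)

text \<open>The equation reads q'/q = d p'/p, as for q proportional to p^d; comparing leading
  coefficients in characteristic 0 gives the degree.\<close>

lemma degree_log_derivative:
  fixes p q :: "'a::{idom, ring_char_0} poly"
  assumes eq: "p * pderiv q = of_nat d * q * pderiv p" and "p \<noteq> 0" "q \<noteq> 0" "d > 0" "pderiv p \<noteq> 0"
  shows "degree q = d * degree p"
proof -
  have lc: "lead_coeff (pderiv r) = of_nat (degree r) * lead_coeff r" if "pderiv r \<noteq> 0" for r :: "'a poly"
  proof -
    have "degree r \<noteq> 0" using that by (simp add: pderiv_eq_0_iff)
    then show ?thesis by (simp add: degree_pderiv coeff_pderiv del: of_nat_Suc)
  qed
  have "of_nat d * q * pderiv p \<noteq> 0" using assms by auto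
  then have "pderiv q \<noteq> 0" using eq by auto
  have "lead_coeff (p * pderiv q) = lead_coeff (of_nat d * q * pderiv p)" using eq by simp
  then have "of_nat (degree q) * (lead_coeff p * lead_coeff q)
      = of_nat (d * degree p) * (lead_coeff p * lead_coeff q)"
    by (simp only: lead_coeff_mult lc[OF \<open>pderiv q \<noteq> 0\<close>] lc[OF assms(5)] lead_coeff_of_nat of_nat_mult mult_ac)
  then show ?thesis using assms by (simp del: of_nat_mult)
qed

text \<open>The coefficients in \<open>z\<close> of \<open>nilp_equations\<close> for the map \<open>(\<Sum>k. u k z^k, v0 + v1 z, h)\<close>.\<close>

locale z_coefficients =
  fixes u :: "nat \<Rightarrow> 'a::{alg_closed_field, field_char_0} poly poly" and v0 v1 h :: "'a poly poly"
    and c :: "nat \<Rightarrow> 'a poly poly"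
  defines "c \<equiv> \<lambda>k. of_nat k * u k"
  assumes T0: "dx (u 0) + dy v0 = 0" and T1: "dx (u 1) + dy v1 = 0"
    and T: "\<And>k. k \<ge> 2 \<Longrightarrow> dx (u k) = 0"
    and M0: "br (u 0) v0 - u 1 * dx h - v1 * dy h = 0"
    and M: "\<And>k. br (u (Suc k)) v0 + br (u k) v1 - c (Suc (Suc k)) * dx h = 0"
    and D0: "v1 * br h (u 0) = u 1 * br h v0"
    and D: "\<And>k. v1 * br h (u (Suc k)) = c (Suc (Suc k)) * br h v0 + c (Suc k) * br h v1"
    and v1: "v1 \<noteq> 0" and h: "\<not> (dx h = 0 \<and> dy h = 0)"
begin

lemma br_commute: "br f g = 0 \<Longrightarrow> br g f = 0"
  unfolding br_def by algebra

text \<open>By \<open>T1\<close> and \<open>M\<close>, the pair \<open>u 1\<close>,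
  \<open>v1\<close> itself has nilpotent plane Jacobian, so \<open>nilp_imp_dependent\<close> leaves
  few cases; the nonproportional ones contradict the nonzero gradient of \<open>h\<close>.\<close>

lemma degree_1_proportional:
  assumes top: "\<And>k. k \<ge> 2 \<Longrightarrow> u k = 0"
  shows "\<exists>l. u 1 = [:[:l:]:] * v1"
proof -
  have c: "c k = 0" if "k \<ge> 2" for k using top[OF that] by (simp add: c_def)
  have c1: "c 1 = u 1" by (simp add: c_def)
  have D1: "v1 * br h (u 1) = u 1 * br h v1" using D[of 0] c c1 by simp
  have M1: "br (u 1) v0 + br (u 0) v1 = 0" using M[of 0] c by simp
  have "br (u 1) v1 = 0" using M[of 1] c top[of 2] by (simp add: br_def numeral_2_eq_2)
  then have "dx (u 1) * dy v1 = dy (u 1) * dx v1" by (simp add: br_def)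
  from nilp_imp_dependent[OF T1 this] show ?thesis
  proof (elim disjE exE conjE)
    assume uy: "dy (u 1) = 0" and ux: "dx (u 1) = 0" and vy: "dy v1 = 0"
    obtain a where a: "u 1 = [:[:a:]:]" using dx_eq_0D[OF ux uy] .
    show ?thesis
    proof (cases "dx v1 = 0 \<or> a = 0")
      case True
      then show ?thesis
      proof
        assume "dx v1 = 0"
        then obtain b where b: "v1 = [:[:b:]:]" using dx_eq_0D vy by blast
        with v1 have "u 1 = [:[:a / b:]:] * v1" by (simp only: a) simp
        then show ?thesis ..
      next
        assume "a = 0"
        then have "u 1 = [:[:0:]:] * v1" by (simp only: a) simp
        then show ?thesis ..
      qed
    next
      \<comment> \<open>Here \<open>u 1\<close> is a nonzero constant and \<open>v1\<close> depends
        on x alone. The brackets force h and \<open>u 0\<close> to be free of y, after which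
        \<open>D0\<close>, \<open>T0\<close> and \<open>M0\<close> give h_x = 0.\<close>
      case False
      then have vx: "dx v1 \<noteq> 0" by simp
      have u1: "u 1 \<noteq> 0" using False by (simp only: a) simp
      have "br h (u 1) = 0" "br (u 1) v0 = 0" by (simp_all only: a br_const)
      then have "br h v1 = 0" "br (u 0) v1 = 0" using D1 M1 u1 by simp_all
      then have hy: "dy h = 0" and u0y: "dy (u 0) = 0" using vx vy by (simp_all add: br_def)
      then have hx: "dx h \<noteq> 0" using h by simp
      have "u 1 * (dx h * dy v0) = 0" using D0 hy u0y by (simp add: br_def)
      then have v0y: "dy v0 = 0" using u1 hx by simp
      then have "dx (u 0) = 0" using T0 by simp
      then have "u 1 * dx h = 0" using M0 hy u0y by (simp add: br_def)
      then show ?thesis using u1 hx by simp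
    qed
  next
    fix b k
    assume v: "v1 = [:[:b:]:] * u 1 + [:[:k:]:]" and ux: "dx (u 1) = - [:[:b:]:] * dy (u 1)"
      and uy: "dy (u 1) \<noteq> 0"
    show ?thesis
    proof (cases "k = 0")
      case True
      with v v1 have "b \<noteq> 0" by auto
      with v True have "u 1 = [:[:inverse b:]:] * v1" by (simp add: pCons_one)
      then show ?thesis ..
    next
      case False
      \<comment> \<open>The offset \<open>K\<close> is what survives when v1 = B u1 + K is inserted:
        one finds in turn that K times br h (u 1), br h (u 0) and h_y vanishes.\<close>
      define B K where "B = [:[:b:]:]" and "K = [:[:k:]:]"
      have K: "K \<noteq> 0" using False by (simp add: K_def)
      have B': "dx B = 0" "dy B = 0" "dx K = 0" "dy K = 0" by (simp_all add: B_def K_def dx_pCons)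
      have v': "v1 = B * u 1 + K" using v by (simp add: B_def K_def)
      have vx: "dx v1 = B * dx (u 1)" and vy: "dy v1 = B * dy (u 1)"
        unfolding v' by (simp_all add: dx_add dx_mult pderiv_add pderiv_mult B')
      have "K * br h (u 1) = 0" using D1 v' vx vy unfolding br_def by algebra
      then have hu1: "br h (u 1) = 0" using K by simp
      have "br (u 1) (v0 - B * u 0) = 0"
        using M1 vx vy unfolding br_def by (simp add: dx_diff dx_mult pderiv_diff pderiv_mult B') algebra
      then have "br h (v0 - B * u 0) = 0"
        using br_trans_eq_0[of "u 1" h "v0 - B * u 0"] br_commute[OF hu1] uy by simp
      then have hv0: "br h v0 = B * br h (u 0)"
        unfolding br_def by (simp add: dx_diff dx_mult pderiv_diff pderiv_mult B') algebra
      have "K * br h (u 0) = 0" using D0 hv0 v' by algebra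
      then have "br h (u 0) = 0" using K by simp
      then have "br (u 0) v0 = 0" using br_trans_eq_0[OF _ _ h] hv0 by simp
      then have rel: "u 1 * dx h + v1 * dy h = 0" using M0 by algebra
      have "dy (u 1) * (dx h + B * dy h) = 0"
        using hu1 ux unfolding br_def B_def[symmetric] by algebra
      then have hx: "dx h + B * dy h = 0" using uy by simp
      then have "K * dy h = 0" using rel v' by algebra
      then show ?thesis using K hx h by simp
    qed
  qed
qed

lemma degree_c_mult:
  assumes "v1 * dy (u d) = c d * dy v1" and "dy v1 \<noteq> 0" and "c d \<noteq> 0" and "f \<noteq> 0"
  shows "degree (c d * f) = d * degree v1 + degree f"
proof -
  have ud: "u d \<noteq> 0" and d: "d > 0" using assms(3) by (auto simp: c_def intro: gr0I)
  have "degree (u d) = d * degree v1"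
    using assms(1,2) v1 ud d by (intro degree_log_derivative) (simp_all add: c_def)
  moreover have "degree (c d) = degree (u d)"
    using ud d by (simp add: c_def degree_mult_eq)
  ultimately show ?thesis using assms(3,4) by (simp add: degree_mult_eq)
qed

text \<open>Equation \<open>i\<close> would equate y-degree 2 deg v1 - 1 with a y-degree of at least
  2 deg v1.\<close>

lemma no_degree_2:
  assumes d2: "d = 2" and cd: "c d \<noteq> 0" and v0x: "dx v0 \<noteq> 0"
    and i: "- (v1 * dy v1) = c d * dx v0" and log: "v1 * dy (u d) = c d * dy v1"
  shows False
proof -
  have v1y: "dy v1 \<noteq> 0" using i cd v0x by auto
  have "degree (c d * dx v0) = degree (v1 * dy v1)" using i by (metis degree_minus)
  also have "\<dots> = degree v1 + (degree v1 - 1)" using v1 v1y by (simp add: degree_mult_eq degree_pderiv)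
  finally have "d * degree v1 + degree (dx v0) = degree v1 + (degree v1 - 1)"
    using degree_c_mult[OF log v1y cd v0x] by simp
  moreover have "degree v1 \<noteq> 0" using v1y by (simp add: pderiv_eq_0_iff)
  ultimately show False using d2 by simp
qed

text \<open>With d = k + 2, the top coefficients of the minor and determinant equations are
  combined. The cases are whether v1 depends on x, then whether h does, then whether v1 depends on
  y; each ends in a clash of degrees or in the vanishing of a nonzero factor.\<close>

lemma top_degree_less_2:
  assumes d: "u d \<noteq> 0" and top: "\<And>k. k > d \<Longrightarrow> u k = 0"
  shows "d < 2"
proof (rule ccontr)
  assume "\<not> d < 2"
  then obtain k where dk: "d = Suc (Suc k)" by (metis add_2_eq_Suc le_Suc_ex not_less)
  have cd: "c d \<noteq> 0" using d dk by (simp add: c_def del: of_nat_Suc)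
  have c_top: "c j = 0" if "j > d" for j using top[OF that] by (simp add: c_def)
  have udx: "dx (u d) = 0" using T[of d] dk by simp
  have M2: "br (u d) v1 = 0" using M[of d] c_top[of "Suc (Suc d)"] top[of "Suc d"] by (simp add: br_def)
  have M1: "br (u d) v0 + br (u (Suc k)) v1 = 0"
    using M[of "Suc k"] c_top[of "Suc d"] dk by simp
  have M3: "br (u (Suc k)) v0 + br (u k) v1 - c d * dx h = 0" using M[of k] dk by simp
  have D2: "v1 * br h (u d) = c d * br h v1"
    using D[of "Suc k"] c_top[of "Suc d"] dk by simp
  have D1: "v1 * br h (u (Suc k)) = c d * br h v0 + c (Suc k) * br h v1" using D[of k] dk by simp
  show False
  proof (cases "dx v1 = 0")
    \<comment> \<open>Here \<open>u d\<close> is constant and every bracket with \<open>h\<close>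
      vanishes; all gradients are parallel and \<open>M3\<close> reduces to c_d h_x = 0.\<close>
    case v1x: False
    have "dy (u d) * dx v1 = 0" using M2 udx by (simp add: br_def)
    then have udy: "dy (u d) = 0" using v1x by simp
    have "br h (u d) = 0" "br (u d) v0 = 0" by (simp_all add: br_def udx udy)
    then have hv1: "br h v1 = 0" and uk: "br (u (Suc k)) v1 = 0" using D2 M1 cd by auto
    have hx: "dx h \<noteq> 0"
    proof
      assume "dx h = 0"
      then show False using hv1 v1x h by (simp add: br_def)
    qed
    have flip: "br f g = 0" if "br g f = 0" for f g :: "'a poly poly"
      using that unfolding br_def by algebra
    have "br h (u (Suc k)) = 0"
      by (rule br_trans_eq_0[of v1]) (use flip hv1 uk v1x in auto)
    then have hv0: "br h v0 = 0" using D1 hv1 cd by auto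
    have hu: "br h (u j) = 0" for j
    proof (cases j)
      case 0
      then show ?thesis using D0 hv0 v1 by simp
    next
      case (Suc i)
      then show ?thesis using D[of i] hv0 hv1 v1 by simp
    qed
    have "br (u (Suc k)) v0 = 0" "br (u k) v1 = 0"
      by (rule br_trans_eq_0[OF hu]; use hv0 hv1 h in simp)+
    then show False using M3 cd hx by simp
  next
    case v1x: True
    show False
    proof (cases "dx h = 0")
      \<comment> \<open>Cancelling h_y in \<open>D\<close> expresses v1 times the x-derivatives of
        the \<open>u j\<close> through \<open>dx v0\<close>; with \<open>T\<close> this leaves only
        d = 2.\<close>
      case hx: True
      then have hy: "dy h \<noteq> 0" using h by simp
      have E0: "v1 * dx (u 0) = u 1 * dx v0"
      proof -
        have "dy h * (v1 * dx (u 0) - u 1 * dx v0) = 0"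
          using D0 hx unfolding br_def by algebra
        then show ?thesis using hy by simp
      qed
      have E: "v1 * dx (u (Suc j)) = c (Suc (Suc j)) * dx v0" for j
      proof -
        have "dy h * (v1 * dx (u (Suc j)) - c (Suc (Suc j)) * dx v0) = 0"
          using D[of j] hx v1x unfolding br_def by algebra
        then show ?thesis using hy by simp
      qed
      have v0x: "dx v0 \<noteq> 0"
      proof
        assume v0x: "dx v0 = 0"
        then have "dx (u 0) = 0" using E0 v1 by simp
        then have "dy v0 = 0" using T0 by simp
        then have "v1 * dy h = 0" using M0 v0x hx by (simp add: br_def)
        then show False using v1 hy by simp
      qed
      have "k = 0"
      proof (rule ccontr)
        assume "k \<noteq> 0"
        then have "dx (u (Suc k)) = 0" using T[of "Suc k"] by simp
        then show False using E[of k] v0x cd dk by simp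
      qed
      then have d2: "d = 2" using dk by simp
      have i: "- (v1 * dy v1) = c d * dx v0"
        using E[of 0] T1 d2 by (simp add: eq_neg_iff_add_eq_0[symmetric] numeral_2_eq_2)
      have ii: "dy (u d) * dx v0 = - (dy v1)\<^sup>2"
        proof -
          have "dx (u (Suc k)) = - dy v1" using T1 \<open>k = 0\<close> by (simp add: eq_neg_iff_add_eq_0)
          then show ?thesis using M1 udx v1x unfolding br_def by algebra
        qed
      have log: "v1 * dy (u d) = c d * dy v1"
      proof -
        have "dx v0 * (v1 * dy (u d) - c d * dy v1) = 0" using i ii by algebra
        then show ?thesis using v0x by simp
      qed
      show False by (rule no_degree_2[OF d2 cd v0x i log])
    next
      case hx: False
      have log: "v1 * dy (u d) = c d * dy v1"
      proof -
        have "dx h * (v1 * dy (u d) - c d * dy v1) = 0"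
          using D2 udx v1x unfolding br_def by algebra
        then show ?thesis using hx by simp
      qed
      show False
      proof (cases "dy v1 = 0")
        case v1y: False
        have udy: "dy (u d) \<noteq> 0" using log v1y cd by auto
        show False
        proof (cases "k = 0")
          case True
          then have d2: "d = 2" using dk by simp
          have ii: "dy (u d) * dx v0 = - (dy v1)\<^sup>2"
            proof -
          have "dx (u (Suc k)) = - dy v1" using T1 True by (simp add: eq_neg_iff_add_eq_0)
          then show ?thesis using M1 udx v1x unfolding br_def by algebra
        qed
          have "dy v1 * (c d * dx v0 + v1 * dy v1) = 0" using ii log by algebra
          then have i: "- (v1 * dy v1) = c d * dx v0"
            using v1y by (simp add: neg_eq_iff_add_eq_0 add.commute)
          then have "dx v0 \<noteq> 0" using v1 v1y by auto
          then show False using no_degree_2[OF d2 cd] i log by blast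
        next
          \<comment> \<open>For k > 0, v0 is free of x and \<open>M3\<close> ties h_x to the
            x-derivative of \<open>u k\<close>. That derivative vanishes unless k = 1, where
            y-degrees clash: at least 3 deg v1 against 2 (deg v1 - 1).\<close>
          case False
          then have "dx (u (Suc k)) = 0" using T[of "Suc k"] by simp
          then have "dy (u d) * dx v0 = 0" using M1 udx v1x unfolding br_def by simp
          then have v0x: "dx v0 = 0" using udy by simp
          have rel: "dx (u k) * dy v1 = c d * dx h"
            using M3 v0x v1x \<open>dx (u (Suc k)) = 0\<close> by (simp add: br_def)
          show False
          proof (cases "k = 1")
            case True
            then have d3: "d = 3" using dk by simp
            have "dx (u k) = - dy v1" using T1 True by (simp add: eq_neg_iff_add_eq_0)
            then have "- ((dy v1)\<^sup>2) = c d * dx h" using rel by algebra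
            then have "degree (c d * dx h) = degree ((dy v1)\<^sup>2)" by (metis degree_minus)
            also have "\<dots> = 2 * (degree v1 - 1)"
              using v1y by (simp add: degree_power_eq degree_pderiv)
            finally have "d * degree v1 + degree (dx h) = 2 * (degree v1 - 1)"
              using degree_c_mult[OF log v1y cd hx] by simp
            moreover have "degree v1 \<noteq> 0" using v1y by (simp add: pderiv_eq_0_iff)
            ultimately show False using d3 by simp
          next
            case False
            then have "dx (u k) = 0" using T[of k] \<open>k \<noteq> 0\<close> by simp
            then show False using rel cd hx by simp
          qed
        qed
      next
        \<comment> \<open>Now \<open>v1\<close> and \<open>u d\<close> are constant. Eliminating the
          derivatives of v0, h and \<open>u 0\<close> leads to (v1 p)^2 = 0, although
          \<open>r1\<close> makes \<open>p\<close> nonzero.\<close>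
        case v1y: True
        have udy: "dy (u d) = 0" using log v1y v1 by simp
        have uSx: "dx (u (Suc k)) = 0"
          using T[of "Suc k"] T1 v1y by (cases "k = 0") auto
        define p where "p = dy (u (Suc k))"
        define E where "E = c d"
        have E: "E \<noteq> 0" using cd by (simp add: E_def)
        have r1: "- (p * dx v0) = E * dx h"
          using M3 uSx v1x v1y unfolding br_def p_def E_def by simp
        have r2: "v1 * (dx h * p) = E * (dx h * dy v0 - dy h * dx v0)"
          using D1 uSx v1x v1y unfolding br_def p_def E_def by simp
        have "E * dx h \<noteq> 0" using E hx by simp
        then have v0x: "dx v0 \<noteq> 0" and p: "p \<noteq> 0" using r1 by auto
        have "dx v0 * (v1 * p\<^sup>2 - E * (p * dy v0 + E * dy h)) = 0" using r1 r2 by algebra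
        then have r3: "v1 * p\<^sup>2 = E * (p * dy v0 + E * dy h)" using v0x by simp
        have "v1 * p * (- (E * dx v0 * dy (u 0)) - (v1 * p - E * dy v0) * dx (u 0) + u 1 * p * dx v0) = 0"
          using D0 r1 r3 unfolding br_def by algebra
        then have r4: "- (E * dx v0 * dy (u 0)) - (v1 * p - E * dy v0) * dx (u 0) + u 1 * p * dx v0 = 0"
          using v1 p by simp
        have "(v1 * p)\<^sup>2 = 0" using M0 T0 r1 r3 r4 unfolding br_def by algebra
        then show False using v1 p by simp
      qed
    qed
  qed
qed

end

text \<open>Comparing coefficients of z yields the locale \<open>z_coefficients\<close>, which
  bounds the z-degree of U by 1 and makes its z-coefficient a constant multiple of that of
  V.\<close>

lemma diff_z_proportional:
  fixes U V W :: "'a::{alg_closed_field, field_char_0} poly3"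
  assumes nil: "nilp_equations U V W" and Wz: "diff_z W = 0" and V1: "degree V = 1" 
    and W0: "at0 W = 0" and ind: "indep3 U V W"
  obtains l where "diff_z (U - Const3 l * V) = 0"
proof -
  obtain h where h: "W = [:h:]" using Wz pderiv_iszero unfolding diff_z_def by blast
  define u where "u = coeff U"
  define v0 v1 where "v0 = coeff V 0" and "v1 = coeff V 1"
  have V: "V = [:v0, v1:]"
    by (rule poly_eqI) (use V1 in \<open>auto simp: v0_def v1_def coeff_pCons coeff_eq_0 split: nat.split\<close>)
  have Vd: "diff_x V = [:dx v0, dx v1:]" "diff_y V = [:dy v0, dy v1:]" "diff_z V = [:v1:]"
    unfolding V by (auto intro!: poly_eqI simp: coeff_diff_x coeff_diff_y coeff_pCons diff_z_def
        pderiv_pCons split: nat.split)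
  have eqT: "diff_x U + [:dy v0, dy v1:] = 0"
    and eqM: "[:dy v0, dy v1:] * diff_x U - [:dx v0, dx v1:] * diff_y U - [:dx h:] * diff_z U - [:v1 * dy h:] = 0"
    and eqD: "[:v1:] * ([:dx h:] * diff_y U - [:dy h:] * diff_x U)
      = [:dx h * dy v0 - dy h * dx v0, dx h * dy v1 - dy h * dx v1:] * diff_z U"
    using nil unfolding nilp_equations_def h Vd by (simp_all add: mult.commute)
  note cf = coeff_diff_x coeff_diff_y coeff_diff_z coeff_pCons u_def[symmetric]
  interpret z_coefficients u v0 v1 h "\<lambda>k. of_nat k * u k"
  proof unfold_locales
    show "dx (u 0) + dy v0 = 0" "dx (u 1) + dy v1 = 0"
      using arg_cong[OF eqT, of "\<lambda>p. coeff p 0"] arg_cong[OF eqT, of "\<lambda>p. coeff p 1"]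
      by (simp_all add: cf)
    show "dx (u k) = 0" if "k \<ge> 2" for k
      using arg_cong[OF eqT, of "\<lambda>p. coeff p k"] that
      by (auto simp: cf split: nat.splits)
    show "br (u 0) v0 - u 1 * dx h - v1 * dy h = 0"
      using arg_cong[OF eqM, of "\<lambda>p. coeff p 0"] by (simp add: cf br_def mult.commute)
    show "br (u (Suc k)) v0 + br (u k) v1 - of_nat (Suc (Suc k)) * u (Suc (Suc k)) * dx h = 0" for k
      using arg_cong[OF eqM, of "\<lambda>p. coeff p (Suc k)"]
      by (simp add: cf br_def algebra_simps del: of_nat_Suc)
    show "v1 * br h (u 0) = u 1 * br h v0"
      using arg_cong[OF eqD, of "\<lambda>p. coeff p 0"] by (simp add: cf br_def mult.commute)
    show "v1 * br h (u (Suc k)) = of_nat (Suc (Suc k)) * u (Suc (Suc k)) * br h v0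
        + of_nat (Suc k) * u (Suc k) * br h v1" for k
      using arg_cong[OF eqD, of "\<lambda>p. coeff p (Suc k)"]
      by (simp add: cf br_def mult_ac del: of_nat_Suc)
    show "v1 \<noteq> 0" using V1 by (auto simp: V)
    show "\<not> (dx h = 0 \<and> dy h = 0)"
    proof
      assume "dx h = 0 \<and> dy h = 0"
      then obtain k where "h = [:[:k:]:]" using dx_eq_0D by blast
      then have "W = 0" using W0 by (simp add: h eval3_def)
      then have "Const3 0 * U + Const3 0 * V + Const3 1 * W = 0" by simp
      then show False using indep3D[OF ind] by fastforce
    qed
  qed
  have deg: "degree U < 2"
  proof (cases "U = 0")
    case False
    then show ?thesis
      by (intro top_degree_less_2) (simp_all add: u_def coeff_eq_0)
  qed simp
  then have "u k = 0" if "k \<ge> 2" for k using that by (simp add: u_def coeff_eq_0)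
  then obtain l where l: "u 1 = [:[:l:]:] * v1" using degree_1_proportional by blast
  have U: "U = [:u 0, u 1:]"
    by (rule poly_eqI) (use deg in \<open>auto simp: u_def coeff_pCons coeff_eq_0 split: nat.split\<close>)
  have "diff_z (U - Const3 l * V) = 0"
    by (subst U) (simp add: V Const3_def l[simplified] diff_z_def pderiv_pCons)
  then show ?thesis by (rule that)
qed

section \<open>The three cases of the classification\<close>

theorem corollary4p2:
  fixes u v h :: "'a::{alg_closed_field, field_char_0} poly3"
    and H :: "('a poly3)^3"
  assumes H: "H = vector [u, v, h]"
    and h_xy: "deg_z h = 0"
    and v_z: "deg_z v \<le> 1"
    and H0: "\<forall>i. eval3 (H $ i) 0 0 0 = 0"
    and indep: "lin_indep3 H"
    and nilp: "nilpotent_matrix (poly_jacobian H)"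
  shows "(deg_z u = 0 \<and> gcd (deg_y u) (deg_y h) \<le> 3 \<longrightarrow> form_A H) \<and>
         (deg_z v = 0 \<and> gcd (deg_x v) (deg_x h) \<le> 3 \<longrightarrow> form_B H) \<and>
         (deg_z u * deg_z v \<ge> 1 \<and>
            (\<exists>l :: 'a. gcd (total_deg (subst3 u varX varY 0 - Const3 l * subst3 v varX varY 0))
                          (total_deg h) \<le> 3) \<longrightarrow>
            (\<exists>T :: 'a^3^3. invertible T \<and> form_A (conj3 T H)))"
proof -
  have hz: "diff_z h = 0" using h_xy by (simp add: diff_z_eq_0_iff)
  have u0: "at0 u = 0" and v0: "at0 v = 0" and h0: "at0 h = 0"
    using H0 by (simp_all add: H forall_3)
  have ind: "indep3 u v h" using indep unfolding H by (rule indep3_of_lin_indep3)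
  have eqs: "nilp_equations u v h" using nilp hz unfolding H by (rule nilp_equations_of_nilpotent)
  have A: "form_A H" if "deg_z u = 0"
    unfolding H using eqs hz u0 v0 h0 ind that
    by (intro form_A_of_nilp_equations) (simp_all add: diff_z_eq_0_iff)
  have B: "form_B H" if "deg_z v = 0"
    unfolding H
  proof (rule form_B_of_swap, rule form_A_of_nilp_equations)
    show "diff_z (swap v) = 0" "diff_z (swap h) = 0"
      using that hz by (simp_all add: diff_swap swap_hom flip: diff_z_eq_0_iff)
  qed (simp_all add: nilp_equations_swap[OF eqs] indep3_swap[OF ind] at0_swap u0 v0 h0)
  \<comment> \<open>The degree hypotheses give degree 1 of v in z; the shear by the resulting
    constant \<open>l\<close> makes the first component free of z, so the argument for form (A)
    applies.\<close>
  have C: "\<exists>T :: 'a^3^3. invertible T \<and> form_A (conj3 T H)" if "deg_z u * deg_z v \<ge> 1"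
  proof -
    have "degree v = 1" using v_z that by (cases "degree v") (auto simp: deg_z_eq_degree)
    then obtain l where l: "diff_z (u - Const3 l * v) = 0"
      using diff_z_proportional[OF eqs hz _ h0 ind] by blast
    have d0: "at0 (u - Const3 l * v) = 0" using u0 v0 by (simp add: eval3_def)
    have "form_A (vector [shear l (u - Const3 l * v), shear l v, shear l h])"
      by (rule form_A_of_nilp_equations)
        (simp_all add: nilp_equations_shear[OF eqs] indep3_shear[OF ind] at0_shear d0 v0 h0
          diff_shear l hz shear_hom(5))
    then show ?thesis
      unfolding H using conj3_shear_matrix invertible_shear_matrix by metis
  qed
  show ?thesis using A B C by blast
qed

end
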